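(* In the setting described in the context, if $r=1$, then $$\omega_L=\widetilde\omega_L=\omega_U=\omega=\hat{\boldsymbol\pi}\,C^{-1}\boldsymbol\lambda,$$ and moreover $\omega_L^*=\omega$ whenever $\omega_L^*$ is defined, that is, when the environmental jump chain is cyclic ($\hat X_k=(k\bmod m)+1$ for all $k\ge 0$).
   Context: Setting. Let $\{X(t):t\ge0\}$ (the random environment) be an irreducible continuous-time Markov chain on $\{1,\ldots,m\}$ with generator $Q$; put $c_\ell=|Q_{\ell\ell}|>0$ and $C=\mathrm{diag}(c_1,\ldots,c_m)$. Let $\{\hat X_k:k\ge0\}$ be its jump chain, with transition matrix $\hat P=I+C^{-1}Q$ and stationary probability (row) vector $\hat{\boldsymbol\pi}$, and let $\{\xi_k:k\ge0\}$ be the successive sojourn times (given the jump chain, the $\xi_k$ are independent and $\xi_k$ is exponential with parameter $c_{\hat X_k}$). Put $\widetilde P=\mathrm{diag}(\hat{\boldsymbol\pi})^{-1}\hat P^T\mathrm{diag}(\hat{\boldsymbol\pi})$. For each $\ell\in\{1,\ldots,m\}$, $\Omega_\ell$ is a real irreducible $r\times r$ matrix with nonnegative off-diagonal entries ($r$ is the number of types of the branching process; for $r=1$, $\Omega_\ell$ is a real number). Write $\hat\Omega_k=\Omega_{\hat X_k}$. Let $\lambda_\ell$ be the eigenvalue of $\Omega_\ell$ of maximal real part (it is real), and $\boldsymbol\lambda=(\lambda_1,\ldots,\lambda_m)^\top$. Let $\boldsymbol u_\ell$ (row) and $\boldsymbol v_\ell=(v_{\ell,1},\ldots,v_{\ell,r})^\top$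 be the strictly positive left and right eigenvectors of $\Omega_\ell$ for $\lambda_\ell$, normalised by $\boldsymbol u_\ell\boldsymbol 1=1$, $\boldsymbol u_\ell\boldsymbol v_\ell=1$. Put $\Omega_\ell^*=\Omega_\ell-\lambda_\ell I$, $\Delta_\ell=\mathrm{diag}(\boldsymbol v_\ell)$, $\Delta'_\ell=\mathrm{diag}(\boldsymbol u_\ell)$, $\Theta_\ell=\Delta_\ell^{-1}\Omega_\ell^*\Delta_\ell$, $\Theta'_\ell=(\Delta'_\ell)^{-1}(\Omega_\ell^* )^T\Delta'_\ell$, $M_\ell=c_\ell[(c_\ell+\lambda_\ell)I-\Omega_\ell]^{-1}$, $N_\ell=c_\ell(c_\ell I-\Theta_\ell)^{-1}$, $\widetilde N_\ell=c_\ell(c_\ell I-\Theta'_\ell)^{-1}$, and let $M,N,\widetilde N$ be the block-diagonal matrices of order $rm$ with diagonal blocks $M_\ell,N_\ell,\widetilde N_\ell$, $1\le \ell\le m$. Growth rate: $\omega=\lim_{n\to\infty}\frac1n\log\{e^{\hat\Omega_0\xi_0}e^{\hat\Omega_1\xi_1}\cdots e^{\hat\Omega_{n-1}\xi_{n-1}}\}_{ij}$ a.s., which is known to exist almost surely and to be a constant not depending on $i,j$. Bounds (with $\mathrm{sp}$ the spectral radius, $\otimes$ the Kronecker product, logarithms of vectors entrywise): $\omega_U=\hat{\boldsymbol\pi}C^{-1}\boldsymbol\lambda+\log\mathrm{sp}[M(\hat P\otimes I_r)]$; $\omega_L=\hat{\boldsymbol\pi}C^{-1}\boldsymbol\lambda+\boldsymbol\pi^{(1)}(I-N)\log\bar{\boldsymbol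 v}$, with $\boldsymbol\pi^{(1)}$ the stationary probability vector of $N(\hat P\otimes I_r)$ and $\bar{\boldsymbol v}$ the column vector stacking $\boldsymbol v_1,\ldots,\boldsymbol v_m$; $\widetilde\omega_L=\hat{\boldsymbol\pi}C^{-1}\boldsymbol\lambda+\widetilde{\boldsymbol\pi}^{(1)}(I-\widetilde N)\log\bar{\boldsymbol u}^T$, with $\widetilde{\boldsymbol\pi}^{(1)}$ the stationary probability vector of $\widetilde N(\widetilde P\otimes I_r)$ and $\bar{\boldsymbol u}=[\boldsymbol u_1\cdots\boldsymbol u_m]$; when the jump chain is cyclic, $\hat X_k=(k\bmod m)+1$, $$\omega_L^*=\hat{\boldsymbol\pi}C^{-1}\boldsymbol\lambda+\frac1m\sum_{1\le i,j\le r}\alpha_i(N_1\cdots N_m)_{ij}\,\mathbb E\big[\log\mathbb E[R_0\mid\varphi_0=i,\varphi_m=j,\boldsymbol\zeta^*]\big],$$ where $\boldsymbol\alpha N_1\cdots N_m=\boldsymbol\alpha$, $\boldsymbol\alpha\boldsymbol1=1$; $\boldsymbol\zeta^*=(\xi^*_1,\ldots,\xi^*_m)$ has independent components, $\xi^*_\ell$ being exponential with parameter $c_\ell$; given $\boldsymbol\zeta^*$, $\varphi_0,\ldots,\varphi_m$ is a Markov chain on $\{1,\ldots,r\}$ with transition matrix $e^{\Theta_\ell\xi_\ell^*}$ from $\varphi_{\ell-1}$ to $\varphi_\ell$; and $R_0=\dfrac{v_{1,\varphi_0}v_{2,\varphi_1}\cdots v_{m,\varphi_{m-1}}}{v_{m,\varphi_0}v_{1,\varphi_1}\cdots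 v_{m-1,\varphi_{m-1}}}$. The outer expectation is with respect to $\boldsymbol\zeta^*$. *)

theory Defs
  imports "HOL-Probability.Probability"
begin

section \<open>Matrices\<close>

text \<open>The ring operations on \<^typ>\<open>real^'n^'n\<close> are componentwise, so neither \<open>exp\<close> nor \<open>^\<close>
  can be used for matrices.\<close>

primrec mprod :: "(nat \<Rightarrow> real^'n^'n) \<Rightarrow> nat \<Rightarrow> real^'n^'n" where
  "mprod A 0 = mat 1"
| "mprod A (Suc n) = mprod A n ** A n"

definition mexp :: "real^'n^'n \<Rightarrow> real^'n^'n" where
  "mexp A = (\<Sum>k. (1 / fact k) *\<^sub>R mprod (\<lambda>_. A) k)"

definition diag :: "real^'n \<Rightarrow> real^'n^'n" where
  "diag v = (\<chi> i j. if i = j then v $ i else 0)"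

definition logv :: "real^'n \<Rightarrow> real^'n" where
  "logv v = (\<chi> i. ln (v $ i))"

text \<open>Matrices of order \<open>rm\<close> are indexed by pairs (environment state, type).\<close>

definition kronecker :: "real^'m^'m \<Rightarrow> real^'r^'r \<Rightarrow> real^('m \<times> 'r)^('m \<times> 'r)" (infixl \<open>\<otimes>\<^sub>K\<close> 75) where
  "A \<otimes>\<^sub>K B = (\<chi> p q. A $ fst p $ fst q * B $ snd p $ snd q)"

definition block_diag :: "('m::finite \<Rightarrow> real^'r^'r) \<Rightarrow> real^('m \<times> 'r)^('m \<times> 'r)" where
  "block_diag B = (\<chi> p q. if fst p = fst q then B (fst p) $ snd p $ snd q else 0)"

definition stack :: "('m::finite \<Rightarrow> real^'r) \<Rightarrow> real^('m \<times> 'r)" where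
  "stack w = (\<chi> p. w (fst p) $ snd p)"

definition irreducible_matrix :: "real^'n^'n \<Rightarrow> bool" where
  "irreducible_matrix A \<longleftrightarrow> (\<forall>i j. (i, j) \<in> {(k, l). k \<noteq> l \<and> A $ k $ l \<noteq> 0}\<^sup>*)"

definition complex_eigenvalues :: "real^'n^'n \<Rightarrow> complex set" where
  "complex_eigenvalues A =
    {z. \<exists>x :: complex^'n. x \<noteq> 0 \<and> map_matrix complex_of_real A *v x = z *s x}"

definition sp :: "real^'n^'n \<Rightarrow> real" where
  "sp A = (SUP z \<in> complex_eigenvalues A. cmod z)"

definition dominant_eigenvalue :: "real^'n^'n \<Rightarrow> real" where
  "dominant_eigenvalue A =
    (THE l. complex_of_real l \<in> complex_eigenvalues A \<and> (\<forall>z \<in> complex_eigenvalues A. Re z \<le> l))"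

definition left_eigenvector :: "real^'n^'n \<Rightarrow> real^'n" where
  "left_eigenvector A =
    (THE u. (\<forall>i. 0 < u $ i) \<and> u v* A = dominant_eigenvalue A *\<^sub>R u \<and> (\<Sum>i\<in>UNIV. u $ i) = 1)"

definition right_eigenvector :: "real^'n^'n \<Rightarrow> real^'n" where
  "right_eigenvector A =
    (THE v. (\<forall>i. 0 < v $ i) \<and> A *v v = dominant_eigenvalue A *\<^sub>R v \<and> left_eigenvector A \<bullet> v = 1)"

definition stationary_vector :: "real^'n^'n \<Rightarrow> real^'n" where
  "stationary_vector P = (THE p. (\<forall>i. 0 \<le> p $ i) \<and> (\<Sum>i\<in>UNIV. p $ i) = 1 \<and> p v* P = p)"


section \<open>The random environment\<close>

definition rates :: "real^'m^'m \<Rightarrow> real^'m" where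
  "rates Q = (\<chi> l. \<bar>Q $ l $ l\<bar>)"

definition jump_matrix :: "real^'m^'m \<Rightarrow> real^'m^'m" where
  "jump_matrix Q = mat 1 + matrix_inv (diag (rates Q)) ** Q"

definition pihat :: "real^'m^'m \<Rightarrow> real^'m" where
  "pihat Q = stationary_vector (jump_matrix Q)"

definition reversed_jump_matrix :: "real^'m^'m \<Rightarrow> real^'m^'m" where
  "reversed_jump_matrix Q =
    matrix_inv (diag (pihat Q)) ** transpose (jump_matrix Q) ** diag (pihat Q)"

definition exp_law :: "real \<Rightarrow> real measure" where
  "exp_law c = density lborel (\<lambda>t. ennreal (exponential_density c t))"

text \<open>A continuous-time Markov chain \<open>X\<close> with generator \<open>Q\<close>, described through its jump chain
  \<open>Xhat\<close> and its sojourn times \<open>xi\<close>. The initial distribution is arbitrary. Conditional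
  independence of the sojourn times is relative to the sigma-algebra generated by the whole jump chain.\<close>

locale random_environment = prob_space M
  for M :: "'a measure"
    and Q :: "real^'m^'m"
    and X :: "real \<Rightarrow> 'a \<Rightarrow> 'm"
    and Xhat :: "nat \<Rightarrow> 'a \<Rightarrow> 'm"
    and xi :: "nat \<Rightarrow> 'a \<Rightarrow> real" +
  assumes Q_offdiag: "i \<noteq> j \<Longrightarrow> 0 \<le> Q $ i $ j"
    and Q_rows: "(\<Sum>j\<in>UNIV. Q $ i $ j) = 0"
    and Q_irreducible: "irreducible_matrix Q"
    and rates_pos: "0 < rates Q $ l"
    and X_measurable: "0 \<le> t \<Longrightarrow> X t \<in> measurable M (count_space UNIV)"
    and Xhat_measurable: "Xhat k \<in> measurable M (count_space UNIV)"
    and xi_measurable: "xi k \<in> borel_measurable M"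
    and jump_chain:
      "\<P>(x in M. \<forall>k\<le>Suc n. Xhat k x = s k)
        = \<P>(x in M. \<forall>k\<le>n. Xhat k x = s k) * jump_matrix Q $ s n $ s (Suc n)"
    and sojourn_times:
      "(\<And>k. B k \<in> sets borel) \<Longrightarrow>
        AE x in M. real_cond_exp M
            (vimage_algebra (space M) (\<lambda>x k. Xhat k x) (\<Pi>\<^sub>M k\<in>UNIV. count_space UNIV))
            (indicator {x \<in> space M. \<forall>k\<le>n. xi k x \<in> B k}) x
          = (\<Prod>k\<le>n. measure (exp_law (rates Q $ Xhat k x)) (B k))"
    and X_path:
      "AE x in M. \<forall>k t. (\<Sum>i<k. xi i x) \<le> t \<and> t < (\<Sum>i<Suc k. xi i x) \<longrightarrow> X t x = Xhat k x"

definition is_growth_rate ::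
  "'a measure \<Rightarrow> (nat \<Rightarrow> 'a \<Rightarrow> 'm) \<Rightarrow> (nat \<Rightarrow> 'a \<Rightarrow> real) \<Rightarrow> ('m \<Rightarrow> real^'r^'r) \<Rightarrow> real \<Rightarrow> bool" where
  "is_growth_rate M Xhat xi Omega w \<longleftrightarrow>
    (AE x in M. \<forall>i j.
      (\<lambda>n. 1 / real n * ln (mprod (\<lambda>k. mexp (xi k x *\<^sub>R Omega (Xhat k x))) n $ i $ j))
        \<longlonglongrightarrow> w)"

definition growth_rate ::
  "'a measure \<Rightarrow> (nat \<Rightarrow> 'a \<Rightarrow> 'm) \<Rightarrow> (nat \<Rightarrow> 'a \<Rightarrow> real) \<Rightarrow> ('m \<Rightarrow> real^'r^'r) \<Rightarrow> real" where
  "growth_rate M Xhat xi Omega = (THE w. is_growth_rate M Xhat xi Omega w)"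


section \<open>The bounds\<close>

definition Omega_star :: "real^'r^'r \<Rightarrow> real^'r^'r" where
  "Omega_star A = A - mat (dominant_eigenvalue A)"

definition Theta :: "real^'r^'r \<Rightarrow> real^'r^'r" where
  "Theta A = matrix_inv (diag (right_eigenvector A)) ** Omega_star A ** diag (right_eigenvector A)"

definition Theta' :: "real^'r^'r \<Rightarrow> real^'r^'r" where
  "Theta' A = matrix_inv (diag (left_eigenvector A)) ** transpose (Omega_star A)
    ** diag (left_eigenvector A)"

definition M_block :: "real \<Rightarrow> real^'r^'r \<Rightarrow> real^'r^'r" where
  "M_block c A = c *\<^sub>R matrix_inv (mat (c + dominant_eigenvalue A) - A)"

definition N_block :: "real \<Rightarrow> real^'r^'r \<Rightarrow> real^'r^'r" where
  "N_block c A = c *\<^sub>R matrix_inv (mat c - Theta A)"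

definition Ntilde_block :: "real \<Rightarrow> real^'r^'r \<Rightarrow> real^'r^'r" where
  "Ntilde_block c A = c *\<^sub>R matrix_inv (mat c - Theta' A)"

definition M_mat :: "real^'m^'m \<Rightarrow> ('m \<Rightarrow> real^'r^'r) \<Rightarrow> real^('m \<times> 'r)^('m \<times> 'r)" where
  "M_mat Q Omega = block_diag (\<lambda>l. M_block (rates Q $ l) (Omega l))"

definition N_mat :: "real^'m^'m \<Rightarrow> ('m \<Rightarrow> real^'r^'r) \<Rightarrow> real^('m \<times> 'r)^('m \<times> 'r)" where
  "N_mat Q Omega = block_diag (\<lambda>l. N_block (rates Q $ l) (Omega l))"

definition Ntilde_mat :: "real^'m^'m \<Rightarrow> ('m \<Rightarrow> real^'r^'r) \<Rightarrow> real^('m \<times> 'r)^('m \<times> 'r)" where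
  "Ntilde_mat Q Omega = block_diag (\<lambda>l. Ntilde_block (rates Q $ l) (Omega l))"

definition mean_rate :: "real^'m^'m \<Rightarrow> ('m \<Rightarrow> real^'r^'r) \<Rightarrow> real" where
  "mean_rate Q Omega =
    (pihat Q v* matrix_inv (diag (rates Q))) \<bullet> (\<chi> l. dominant_eigenvalue (Omega l))"

definition omega_U :: "real^'m^'m \<Rightarrow> ('m \<Rightarrow> real^'r^'r) \<Rightarrow> real" where
  "omega_U Q Omega =
    mean_rate Q Omega + ln (sp (M_mat Q Omega ** (jump_matrix Q \<otimes>\<^sub>K (mat 1 :: real^'r^'r))))"

definition omega_L :: "real^'m^'m \<Rightarrow> ('m \<Rightarrow> real^'r^'r) \<Rightarrow> real" where
  "omega_L Q Omega = mean_rate Q Omega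
    + (stationary_vector (N_mat Q Omega ** (jump_matrix Q \<otimes>\<^sub>K (mat 1 :: real^'r^'r)))
        v* (mat 1 - N_mat Q Omega))
      \<bullet> logv (stack (\<lambda>l. right_eigenvector (Omega l)))"

definition omega_L_tilde :: "real^'m^'m \<Rightarrow> ('m \<Rightarrow> real^'r^'r) \<Rightarrow> real" where
  "omega_L_tilde Q Omega = mean_rate Q Omega
    + (stationary_vector (Ntilde_mat Q Omega ** (reversed_jump_matrix Q \<otimes>\<^sub>K (mat 1 :: real^'r^'r)))
        v* (mat 1 - Ntilde_mat Q Omega))
      \<bullet> logv (stack (\<lambda>l. left_eigenvector (Omega l)))"


subsection \<open>The bound for a cyclic environment\<close>

text \<open>Below, \<open>lab\<close> enumerates the environment states as \<open>lab 1, \<dots>, lab m\<close> with \<open>m = CARD('m)\<close>,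
  and \<open>z l\<close> is the value of the \<open>l\<close>-th component of the random vector of sojourn times.
  \<open>path_prob\<close> is the probability of the path \<open>\<phi> 0, \<dots>, \<phi> m\<close> given these values and given \<open>\<phi> 0\<close>;
  conditioning on both end points is conditioning on an event of a finite probability space, and
  the distribution of \<open>\<phi> 0\<close> cancels.\<close>

definition path_prob :: "('m::finite \<Rightarrow> real^'r^'r) \<Rightarrow> (nat \<Rightarrow> 'm) \<Rightarrow> (nat \<Rightarrow> real) \<Rightarrow> (nat \<Rightarrow> 'r) \<Rightarrow> real" where
  "path_prob Omega lab z \<phi> =
    (\<Prod>l = 1..CARD('m). mexp (z l *\<^sub>R Theta (Omega (lab l))) $ \<phi> (l - 1) $ \<phi> l)"

definition R0 :: "('m::finite \<Rightarrow> real^'r^'r) \<Rightarrow> (nat \<Rightarrow> 'm) \<Rightarrow> (nat \<Rightarrow> 'r) \<Rightarrow> real" where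
  "R0 Omega lab \<phi> =
    (\<Prod>l = 1..CARD('m). right_eigenvector (Omega (lab l)) $ \<phi> (l - 1))
    / (right_eigenvector (Omega (lab CARD('m))) $ \<phi> 0
       * (\<Prod>l = 1..<CARD('m). right_eigenvector (Omega (lab l)) $ \<phi> l))"

definition bridges :: "'m::finite itself \<Rightarrow> 'r \<Rightarrow> 'r \<Rightarrow> (nat \<Rightarrow> 'r) set" where
  "bridges _ i j = {\<phi> \<in> {0..CARD('m)} \<rightarrow>\<^sub>E UNIV. \<phi> 0 = i \<and> \<phi> CARD('m) = j}"

definition cond_exp_R0 ::
  "('m::finite \<Rightarrow> real^'r^'r) \<Rightarrow> (nat \<Rightarrow> 'm) \<Rightarrow> (nat \<Rightarrow> real) \<Rightarrow> 'r \<Rightarrow> 'r \<Rightarrow> real" where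
  "cond_exp_R0 Omega lab z i j =
    (\<Sum>\<phi> \<in> bridges TYPE('m) i j. R0 Omega lab \<phi> * path_prob Omega lab z \<phi>)
    / (\<Sum>\<phi> \<in> bridges TYPE('m) i j. path_prob Omega lab z \<phi>)"

definition N_prod :: "real^'m^'m \<Rightarrow> ('m \<Rightarrow> real^'r^'r) \<Rightarrow> (nat \<Rightarrow> 'm) \<Rightarrow> real^'r^'r" where
  "N_prod Q Omega lab =
    mprod (\<lambda>k. N_block (rates Q $ lab (k + 1)) (Omega (lab (k + 1)))) CARD('m)"

definition alpha :: "real^'m^'m \<Rightarrow> ('m \<Rightarrow> real^'r^'r) \<Rightarrow> (nat \<Rightarrow> 'm) \<Rightarrow> real^'r" where
  "alpha Q Omega lab =
    (THE a. a v* N_prod Q Omega lab = a \<and> (\<Sum>i\<in>UNIV. a $ i) = 1)"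

definition omega_L_star :: "real^'m^'m \<Rightarrow> ('m \<Rightarrow> real^'r^'r) \<Rightarrow> (nat \<Rightarrow> 'm) \<Rightarrow> real" where
  "omega_L_star Q Omega lab = mean_rate Q Omega
    + 1 / real CARD('m) * (\<Sum>i\<in>UNIV. \<Sum>j\<in>UNIV.
        alpha Q Omega lab $ i * N_prod Q Omega lab $ i $ j
        * (\<integral>z. ln (cond_exp_R0 Omega lab z i j)
             \<partial>(\<Pi>\<^sub>M l\<in>{1..CARD('m)}. exp_law (rates Q $ lab l))))"

end

theory Submission
  imports Defs "HOL-Library.Discrete_Functions"
begin

text \<open>For \<open>r = 1\<close> each \<open>\<Omega>\<^sub>l\<close> is the number \<open>\<lambda>\<^sub>l\<close>, both eigenvectors are \<open>1\<close>, and
  \<open>M = N = N~ = I\<close>. The corrections in \<open>\<omega>\<^sub>L\<close>, its dual and \<open>\<omega>\<^sub>L\<^sup>*\<close> are averages of \<open>ln 1\<close>, and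
  the one in \<open>\<omega>\<^sub>U\<close> is the logarithm of the spectral radius of a stochastic matrix. The matrix
  product is \<open>exp (\<Sum> \<lambda>(X\<^sub>k) \<xi>\<^sub>k)\<close>, so the growth rate requires a strong law of large numbers for
  \<open>\<lambda>(X\<^sub>k) \<xi>\<^sub>k\<close>. With \<open>f\<^sub>l = \<lambda>\<^sub>l / c\<^sub>l\<close> and a solution \<open>g\<close> of the Poisson equation
  \<open>f = g - P g + \<pi> f\<close>, the partial sums split into \<open>n (\<pi> f)\<close>, a bounded term and the partial sums of
  the sequences \<open>\<lambda>(X\<^sub>k) (\<xi>\<^sub>k - 1 / c(X\<^sub>k))\<close> and \<open>g(X\<^sub>k\<^sub>+\<^sub>1) - P g(X\<^sub>k)\<close>. Both are orthogonal and
  bounded in \<open>L\<^sup>2\<close>, which suffices for the strong law; in particular, a periodic jump chain needs no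
  special treatment.\<close>

section \<open>Irreducible stochastic matrices\<close>

locale irreducible_stochastic =
  fixes P :: "real^'m^'m"
  assumes nonneg: "0 \<le> P $ i $ j"
    and row_sum: "(\<Sum>j\<in>UNIV. P $ i $ j) = 1"
    and irreducible: "irreducible_matrix P"
begin

lemma mult_uminus: "P *v (- g) = - (P *v g)"
  by (simp add: vec_eq_iff matrix_vector_mult_def sum_negf)

lemma superharmonic_at_min:
  assumes "\<And>j. g $ i \<le> g $ j"
  shows "g $ i \<le> (P *v g) $ i"
proof -
  have "(\<Sum>j\<in>UNIV. P $ i $ j * g $ i) \<le> (\<Sum>j\<in>UNIV. P $ i $ j * g $ j)"
    by (intro sum_mono mult_left_mono assms nonneg)
  then show ?thesis
    by (simp add: matrix_vector_mult_def row_sum flip: sum_distrib_right)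
qed

lemma ex_le_mult: "\<exists>i. g $ i \<le> (P *v g) $ i"
proof -
  obtain i where "\<And>j. g $ i \<le> g $ j"
    using ex_is_arg_min_if_finite[of UNIV "\<lambda>i. g $ i"]
    by (auto simp: is_arg_min_linorder)
  then show ?thesis
    using superharmonic_at_min by blast
qed

text \<open>Maximum principle: \<open>g - P g\<close> is nonpositive at a minimum of
  \<open>g\<close> and nonnegative at a maximum, so a constant value can only be zero.\<close>

lemma potential_const_eq_0:
  assumes "\<And>i. g $ i - (P *v g) $ i = c"
  shows "c = 0"
proof -
  have "\<exists>i. g $ i - (P *v g) $ i \<le> 0"
    using ex_le_mult[of g] by auto
  moreover have "\<exists>i. 0 \<le> g $ i - (P *v g) $ i"
    using ex_le_mult[of "- g"] by (simp add: mult_uminus)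
  ultimately show ?thesis
    using assms by auto
qed

text \<open>The set where a harmonic function attains its minimum is closed under transitions of
  nonzero probability; by irreducibility it is the whole state space.\<close>

lemma harmonic_imp_const:
  assumes harm: "P *v g = g"
  shows "g $ i = g $ j"
proof -
  obtain k where k: "\<And>j. g $ k \<le> g $ j"
    using ex_is_arg_min_if_finite[of UNIV "\<lambda>i. g $ i"]
    by (auto simp: is_arg_min_linorder)
  have step: "g $ b = g $ k" if "g $ a = g $ k" "P $ a $ b \<noteq> 0" for a b
  proof -
    \<comment> \<open>Since \<open>g $ k\<close> is the minimum, all terms of this sum are
      nonnegative; the sum being zero, each term vanishes.\<close>
    have "(\<Sum>j\<in>UNIV. P $ a $ j * (g $ j - g $ k)) = (P *v g) $ a - g $ k"
      by (simp add: algebra_simps matrix_vector_mult_def sum_subtractf row_sum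
          flip: sum_distrib_left)
    also have "\<dots> = 0"
      using harm that by simp
    finally have "P $ a $ b * (g $ b - g $ k) = 0"
      using sum_nonneg_0[of UNIV "\<lambda>j. P $ a $ j * (g $ j - g $ k)" b] nonneg k by simp
    then show ?thesis
      using that by simp
  qed
  have "g $ l = g $ k" for l
  proof -
    have "(k, l) \<in> {(k, l). k \<noteq> l \<and> P $ k $ l \<noteq> 0}\<^sup>*"
      using irreducible unfolding irreducible_matrix_def by blast
    then show ?thesis
      by (induction rule: rtrancl_induct) (auto intro: step)
  qed
  then show ?thesis
    by metis
qed

text \<open>Adding one coordinate of \<open>g\<close> as a constant turns \<open>I - P\<close>, whose kernel and cokernel are
  one-dimensional, into an invertible map. The constant is the stationary mean of \<open>f\<close>.\<close>

lemma potential_surj: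
  "\<exists>g. \<forall>i. g $ i - (P *v g) $ i + g $ k = f $ i"
proof -
  define T where "T = (\<lambda>g. g - P *v g + (\<chi> i. g $ k))"
  have lin: "linear T"
    unfolding T_def
    by (rule linearI) (auto simp: vec_eq_iff matrix_vector_right_distrib algebra_simps matrix_vector_mult_scaleR)
  have "inj T"
  proof (rule linear_injective_0[OF lin, THEN iffD2], intro allI impI)
    fix g assume "T g = 0"
    then have *: "g $ i - (P *v g) $ i = - g $ k" for i
      by (simp add: T_def vec_eq_iff) (metis add_eq_0_iff add.commute)
    then have 0: "g $ k = 0"
      using potential_const_eq_0[OF *] by simp
    then have "P *v g = g"
      using * by (simp add: vec_eq_iff)
    then have "g $ i = g $ k" for i
      by (rule harmonic_imp_const)
    then show "g = 0"
      using 0 by (simp add: vec_eq_iff)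
  qed
  then obtain g where "T g = f"
    using linear_injective_imp_surjective[OF lin] by (metis surjD)
  then show ?thesis
    by (intro exI[of _ g]) (auto simp: T_def)
qed

text \<open>Pairing with \<open>p\<close> annihilates \<open>g - P g\<close>. This identifies the
  constant in the Poisson equation and gives uniqueness of the stationary vector.\<close>

lemma stationary_inner:
  assumes p: "p v* P = p" "(\<Sum>i\<in>UNIV. p $ i) = 1"
    and g: "\<And>i. g $ i - (P *v g) $ i + c = f $ i"
  shows "p \<bullet> f = c"
proof -
  have "f = g - P *v g + c *\<^sub>R (\<chi> i. 1)"
    using g by (simp add: vec_eq_iff)
  then have "p \<bullet> f = p \<bullet> g - (p v* P) \<bullet> g + c * (p \<bullet> (\<chi> i. 1))"
    by (simp add: inner_simps dot_matrix_vector_mul dot_lmul_matrix)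
  then show ?thesis
    using p by (simp add: inner_vec_def)
qed

text \<open>The stationary vector is built by duality: the constant in the Poisson equation for
  \<open>f\<close> is a positive normalised linear functional of \<open>f\<close>, and its
  coefficients form \<open>p\<close>.\<close>

lemma ex1_stationary:
  "\<exists>!p. (\<forall>i. 0 \<le> p $ i) \<and> (\<Sum>i\<in>UNIV. p $ i) = 1 \<and> p v* P = p"
proof -
  define k :: 'm where "k = undefined"
  obtain G where G: "\<And>f i. G f $ i - (P *v G f) $ i + G f $ k = f $ i"
    using potential_surj[of k] by metis
  define \<phi> where "\<phi> f = G f $ k" for f
  \<comment> \<open>The constant does not depend on the chosen solution. Hence each value of
    \<open>\<phi>\<close> below is found by exhibiting one solution \<open>g\<close> with its
    constant.\<close>
  have \<phi>: "\<phi> f = c" if "\<And>i. g $ i - (P *v g) $ i + c = f $ i" for f g c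
  proof -
    have "(G f - g) $ i - (P *v (G f - g)) $ i = c - \<phi> f" for i
      using G[of f i] that[of i] by (simp add: \<phi>_def matrix_vector_mult_diff_distrib)
    then show ?thesis
      using potential_const_eq_0[of "G f - g" "c - \<phi> f"] by simp
  qed
  have lin: "linear \<phi>"
  proof (rule linearI)
    fix f h :: "real^'m" and r :: real
    show "\<phi> (f + h) = \<phi> f + \<phi> h"
    proof (rule \<phi>)
      fix i
      show "(G f + G h) $ i - (P *v (G f + G h)) $ i + (\<phi> f + \<phi> h) = (f + h) $ i"
        using G[of f i] G[of h i] by (simp add: \<phi>_def matrix_vector_right_distrib)
    qed
    show "\<phi> (r *\<^sub>R f) = r *\<^sub>R \<phi> f"
    proof (rule \<phi>)
      fix i
      show "(r *\<^sub>R G f) $ i - (P *v (r *\<^sub>R G f)) $ i + r *\<^sub>R \<phi> f = (r *\<^sub>R f) $ i"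
        using G[of f i] by (simp add: \<phi>_def matrix_vector_mult_scaleR flip: distrib_left right_diff_distrib)
    qed
  qed
  have pos: "0 \<le> \<phi> f" if "\<And>i. 0 \<le> f $ i" for f
  proof -
    obtain i where "G f $ i \<le> (P *v G f) $ i"
      using ex_le_mult by blast
    then show ?thesis
      using G[of f i] that[of i] by (simp add: \<phi>_def)
  qed
  define p where "p = (\<chi> i. \<phi> (axis i 1))"
  have inner: "p \<bullet> f = \<phi> f" for f
  proof -
    have "\<phi> f = \<phi> (\<Sum>i\<in>UNIV. f $ i *\<^sub>R axis i 1)"
      using basis_expansion[of f] by (simp add: scalar_mult_eq_scaleR)
    also have "\<dots> = p \<bullet> f"
      by (simp add: linear_sum[OF lin] linear_cmul[OF lin] p_def inner_vec_def mult.commute)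
    finally show ?thesis ..
  qed
  have nn: "0 \<le> p $ i" for i
    unfolding p_def by (auto intro!: pos simp: axis_def)
  have "p \<bullet> (\<chi> i. 1) = 1"
    unfolding inner by (rule \<phi>[where g = 0]) (simp add: matrix_vector_mult_def)
  then have sum: "(\<Sum>i\<in>UNIV. p $ i) = 1"
    by (simp add: inner_vec_def)
  have "(p v* P) \<bullet> f = p \<bullet> f" for f
  proof -
    \<comment> \<open>For the right-hand side \<open>f - P f\<close> the function \<open>f\<close>
      itself is a solution with constant zero; this is invariance of \<open>p\<close> in dual
      form.\<close>
    have "p \<bullet> (f - P *v f) = 0"
      unfolding inner by (rule \<phi>[where g = f]) simp
    then show ?thesis
      by (simp add: inner_simps dot_lmul_matrix)
  qed
  then have stat: "p v* P = p"
    by (metis vector_eq_rdot)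
  show ?thesis
  proof (rule ex1I[of _ p])
    fix q
    assume q: "(\<forall>i. 0 \<le> q $ i) \<and> (\<Sum>i\<in>UNIV. q $ i) = 1 \<and> q v* P = q"
    have "q \<bullet> f = p \<bullet> f" for f
      using stationary_inner[of q "G f" "\<phi> f" f] q G by (simp add: inner \<phi>_def)
    then show "q = p"
      by (metis vector_eq_rdot)
  qed (use nn sum stat in auto)
qed

lemma stationary_vector:
  "0 \<le> stationary_vector P $ i" "(\<Sum>i\<in>UNIV. stationary_vector P $ i) = 1"
  "stationary_vector P v* P = stationary_vector P"
  using theI'[OF ex1_stationary] by (auto simp: stationary_vector_def)

lemma poisson_equation:
  "\<exists>g. \<forall>i. f $ i = g $ i - (P *v g) $ i + stationary_vector P \<bullet> f"
proof -
  obtain g where g: "\<And>i. g $ i - (P *v g) $ i + g $ undefined = f $ i"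
    using potential_surj by blast
  then show ?thesis
    using stationary_inner[OF stationary_vector(3,2) g] by metis
qed

end


section \<open>A strong law for orthogonal random variables\<close>

lemma power2_sum_le: "((a::real) + b)\<^sup>2 \<le> 2 * (a\<^sup>2 + b\<^sup>2)"
  using zero_le_power2[of "a - b"] by (simp add: power2_eq_square algebra_simps)

text \<open>Cauchy-Schwarz over the at most \<open>2 * n + 1\<close> terms between
  \<open>n\<^sup>2\<close> and \<open>N\<close>. Extending the block to the next square makes the
  bound independent of \<open>N\<close>.\<close>

lemma sum_square_between_squares:
  fixes y :: "nat \<Rightarrow> real"
  assumes n: "n\<^sup>2 \<le> N" "N < (Suc n)\<^sup>2"
  shows "(\<Sum>k<N. y k)\<^sup>2 \<le>
    2 * ((\<Sum>k<n\<^sup>2. y k)\<^sup>2 + (2 * real n + 1) * (\<Sum>k\<in>{n\<^sup>2..<(Suc n)\<^sup>2}. (y k)\<^sup>2))"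
proof -
  have sub: "{n\<^sup>2..<N} \<subseteq> {n\<^sup>2..<(Suc n)\<^sup>2}"
    using n by auto
  have "N - n\<^sup>2 \<le> 2 * n + 1"
    using n by (simp add: power2_eq_square)
  then have card: "real (card {n\<^sup>2..<N}) \<le> 2 * real n + 1"
    by (metis (mono_tags) card_atLeastLessThan of_nat_1 of_nat_add of_nat_le_iff of_nat_mult of_nat_numeral)
  have "(\<Sum>k\<in>{n\<^sup>2..<N}. y k)\<^sup>2 \<le> (\<Sum>k\<in>{n\<^sup>2..<N}. (y k)\<^sup>2) * card {n\<^sup>2..<N}"
    by (rule sum_squared_le_sum_of_squares)
  also have "\<dots> \<le> (\<Sum>k\<in>{n\<^sup>2..<(Suc n)\<^sup>2}. (y k)\<^sup>2) * (2 * real n + 1)"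
    by (intro mult_mono sum_mono2 card sub sum_nonneg) auto
  finally have gap: "(\<Sum>k\<in>{n\<^sup>2..<N}. y k)\<^sup>2 \<le> (2 * real n + 1) * (\<Sum>k\<in>{n\<^sup>2..<(Suc n)\<^sup>2}. (y k)\<^sup>2)"
    by (simp add: mult.commute)
  have "(\<Sum>k<N. y k) = (\<Sum>k<n\<^sup>2. y k) + (\<Sum>k\<in>{n\<^sup>2..<N}. y k)"
    using n by (metis atLeast0LessThan sum.atLeastLessThan_concat zero_le)
  then show ?thesis
    using power2_sum_le[of "\<Sum>k<n\<^sup>2. y k" "\<Sum>k\<in>{n\<^sup>2..<N}. y k"] gap by simp
qed

text \<open>By monotone convergence the series of the \<open>H n\<close> has finite expectation, so
  it converges almost surely and its terms tend to zero.\<close>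

lemma (in prob_space) AE_tendsto_0_of_summable_expectation:
  fixes H :: "nat \<Rightarrow> 'a \<Rightarrow> real"
  assumes int: "\<And>n. integrable M (H n)" and nn: "\<And>n x. 0 \<le> H n x"
    and sum: "summable (\<lambda>n. expectation (H n))"
  shows "AE x in M. (\<lambda>n. H n x) \<longlonglongrightarrow> 0"
proof -
  have [measurable]: "\<And>n. H n \<in> borel_measurable M"
    using int by auto
  have "(\<integral>\<^sup>+x. (\<Sum>n. ennreal (H n x)) \<partial>M) = (\<Sum>n. \<integral>\<^sup>+x. ennreal (H n x) \<partial>M)"
    by (rule nn_integral_suminf) auto
  also have "\<dots> = (\<Sum>n. ennreal (expectation (H n)))"
    using int nn by (simp add: nn_integral_eq_integral)
  also have "\<dots> = ennreal (\<Sum>n. expectation (H n))"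
    using sum nn by (intro suminf_ennreal2) auto
  finally have "AE x in M. (\<Sum>n. ennreal (H n x)) \<noteq> \<infinity>"
    by (intro nn_integral_PInf_AE) auto
  then show ?thesis
    by eventually_elim (use nn in \<open>auto intro!: summable_LIMSEQ_zero summable_suminf_not_top\<close>)
qed

text \<open>Chebyshev's bound makes the averages converge along the squares; between two consecutive squares
  the partial sums move too little to matter.\<close>

lemma (in prob_space) strong_law_orthogonal:
  fixes Y :: "nat \<Rightarrow> 'a \<Rightarrow> real"
  assumes [measurable]: "\<And>k. Y k \<in> borel_measurable M"
    and sq: "\<And>k. integrable M (\<lambda>x. (Y k x)\<^sup>2)"
    and bound: "\<And>k. expectation (\<lambda>x. (Y k x)\<^sup>2) \<le> C"
    and orth: "\<And>j k. j < k \<Longrightarrow> expectation (\<lambda>x. Y j x * Y k x) = 0"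
  shows "AE x in M. (\<lambda>n. (\<Sum>k<n. Y k x) / real n) \<longlonglongrightarrow> 0"
proof -
  \<comment> \<open>Up to a factor 2, \<open>H n\<close> dominates the squared average at every
    \<open>N\<close> from \<open>n\<^sup>2\<close> up to the next square, for positive
    \<open>n\<close>. Its expectation is of order \<open>1 / n\<^sup>2\<close>, hence
    summable.\<close>
  define S where "S n x = (\<Sum>k<n. Y k x)" for n x
  define G where "G n x = (2 * real n + 1) * (\<Sum>k\<in>{n\<^sup>2..<(Suc n)\<^sup>2}. (Y k x)\<^sup>2)" for n x
  define H where "H n x = ((S (n\<^sup>2) x)\<^sup>2 + G n x) / real n ^ 4" for n x
  have prod: "integrable M (\<lambda>x. Y j x * Y k x)" for j k
  proof (rule Bochner_Integration.integrable_bound)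
    show "integrable M (\<lambda>x. (Y j x)\<^sup>2 + (Y k x)\<^sup>2)"
      using sq by simp
    show "AE x in M. norm (Y j x * Y k x) \<le> norm ((Y j x)\<^sup>2 + (Y k x)\<^sup>2)"
    proof (rule AE_I2)
      fix x
      have "2 * (\<bar>Y j x\<bar> * \<bar>Y k x\<bar>) \<le> (Y j x)\<^sup>2 + (Y k x)\<^sup>2"
        using zero_le_power2[of "\<bar>Y j x\<bar> - \<bar>Y k x\<bar>"] by (simp add: power2_diff)
      moreover have "0 \<le> \<bar>Y j x\<bar> * \<bar>Y k x\<bar>"
        by simp
      ultimately have "\<bar>Y j x\<bar> * \<bar>Y k x\<bar> \<le> (Y j x)\<^sup>2 + (Y k x)\<^sup>2"
        by linarith
      then show "norm (Y j x * Y k x) \<le> norm ((Y j x)\<^sup>2 + (Y k x)\<^sup>2)"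
        by (simp add: abs_mult)
    qed
  qed simp
  have orth': "expectation (\<lambda>x. Y j x * Y k x) = 0" if "j \<noteq> k" for j k
    using orth[of j k] orth[of k j] that by (cases "j < k") (auto simp: mult.commute)
  have S2: "(S n x)\<^sup>2 = (\<Sum>j<n. \<Sum>k<n. Y j x * Y k x)" for n x
    by (simp add: S_def power2_eq_square sum_product)
  have S_int: "integrable M (\<lambda>x. (S n x)\<^sup>2)" for n
    unfolding S2 by (intro Bochner_Integration.integrable_sum prod)
  have S_bound: "expectation (\<lambda>x. (S n x)\<^sup>2) \<le> real n * C" for n
  proof -
    have "expectation (\<lambda>x. (S n x)\<^sup>2) = (\<Sum>j<n. \<Sum>k<n. expectation (\<lambda>x. Y j x * Y k x))"
      unfolding S2 by (simp add: prod)
    also have "\<dots> = (\<Sum>j<n. \<Sum>k<n. if k = j then expectation (\<lambda>x. (Y j x)\<^sup>2) else 0)"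
      by (intro sum.cong refl) (auto simp: orth' power2_eq_square)
    also have "\<dots> = (\<Sum>j<n. expectation (\<lambda>x. (Y j x)\<^sup>2))"
      by simp
    also have "\<dots> \<le> real n * C"
      using sum_bounded_above[of "{..<n}" "\<lambda>j. expectation (\<lambda>x. (Y j x)\<^sup>2)" C] bound by simp
    finally show ?thesis .
  qed
  have G_int: "integrable M (G n)" for n
    unfolding G_def[abs_def] using sq by simp
  have G_bound: "expectation (G n) \<le> (2 * real n + 1)\<^sup>2 * C" for n
  proof -
    have "expectation (G n) = (2 * real n + 1) * (\<Sum>k\<in>{n\<^sup>2..<(Suc n)\<^sup>2}. expectation (\<lambda>x. (Y k x)\<^sup>2))"
      unfolding G_def[abs_def] using sq by simp
    also have "\<dots> \<le> (2 * real n + 1) * (real (card {n\<^sup>2..<(Suc n)\<^sup>2}) * C)"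
      by (intro mult_left_mono sum_bounded_above bound) auto
    also have "real (card {n\<^sup>2..<(Suc n)\<^sup>2}) = 2 * real n + 1"
      by (simp add: power2_eq_square)
    finally show ?thesis
      by (simp add: power2_eq_square mult.assoc)
  qed
  have G_nonneg: "0 \<le> G n x" for n x
    by (auto simp: G_def intro!: mult_nonneg_nonneg sum_nonneg)
  have H_nonneg: "0 \<le> H n x" for n x
    using G_nonneg by (simp add: H_def)
  have H_int: "integrable M (H n)" for n
    unfolding H_def[abs_def] using S_int G_int by simp
  have "0 \<le> expectation (\<lambda>x. (Y 0 x)\<^sup>2)"
    by simp
  with bound[of 0] have C: "0 \<le> C"
    by linarith
  \<comment> \<open>The shift keeps the denominator nonzero. The constant is
    \<open>1 + 3\<^sup>2\<close>: one from the sum up to the square, nine from the gap, where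
    \<open>2 * r + 1\<close> is at most \<open>3 * r\<close>.\<close>
  have H_bound: "expectation (H (Suc n)) \<le> 10 * C * inverse (real (Suc n) ^ 2)" for n
  proof -
    let ?r = "real (Suc n)"
    have "expectation (H (Suc n)) = (expectation (\<lambda>x. (S ((Suc n)\<^sup>2) x)\<^sup>2) + expectation (G (Suc n))) / ?r ^ 4"
      unfolding H_def[abs_def] using S_int G_int by simp
    also have "\<dots> \<le> (?r\<^sup>2 * C + (2 * ?r + 1)\<^sup>2 * C) / ?r ^ 4"
      using S_bound[of "(Suc n)\<^sup>2"] G_bound[of "Suc n"]
      by (intro divide_right_mono add_mono) (simp_all del: of_nat_Suc)
    also have "\<dots> \<le> (?r\<^sup>2 * C + (3 * ?r)\<^sup>2 * C) / ?r ^ 4"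
      using C by (intro divide_right_mono add_mono mult_right_mono power_mono) auto
    also have "\<dots> = 10 * C * inverse (?r ^ 2)"
      by (simp add: field_simps power2_eq_square power4_eq_xxxx del: of_nat_Suc)
    finally show ?thesis .
  qed
  have "summable (\<lambda>n. 10 * C * inverse (real (Suc n) ^ 2))"
    using inverse_power_summable[of 2, where ?'a = real, THEN summable_Suc_iff[THEN iffD2]]
    by (intro summable_mult) simp
  then have "summable (\<lambda>n. expectation (H (Suc n)))"
    by (rule summable_comparison_test_ev[rotated])
      (use H_bound H_nonneg in \<open>auto intro!: always_eventually\<close>)
  then have "AE x in M. (\<lambda>n. H (Suc n) x) \<longlonglongrightarrow> 0"
    by (intro AE_tendsto_0_of_summable_expectation H_int H_nonneg)
  then show ?thesis
  proof eventually_elim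
    fix x
    assume "(\<lambda>n. H (Suc n) x) \<longlonglongrightarrow> 0"
    then have "(\<lambda>n. H n x) \<longlonglongrightarrow> 0"
      by (simp add: filterlim_sequentially_Suc[where f = "\<lambda>n. H n x"])
    \<comment> \<open>Each \<open>N\<close> is assigned to the block that starts at the largest
      square not exceeding it, and the block index tends to infinity with \<open>N\<close>.\<close>
    moreover have "filterlim floor_sqrt at_top at_top"
      unfolding filterlim_at_top_ge[where c = 0]
      by (auto intro!: eventually_at_top_linorderI le_floor_sqrtI)
    ultimately have "(\<lambda>N. H (floor_sqrt N) x) \<longlonglongrightarrow> 0"
      by (rule filterlim_compose)
    then have "(\<lambda>N. 2 * H (floor_sqrt N) x) \<longlonglongrightarrow> 0"
      by (rule tendsto_mult_right_zero)
    moreover have "(S N x / real N)\<^sup>2 \<le> 2 * H (floor_sqrt N) x" if "0 < N" for N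
    proof -
      let ?n = "floor_sqrt N"
      have n: "0 < ?n" "?n\<^sup>2 \<le> N" "N < (Suc ?n)\<^sup>2"
        using that Suc_floor_sqrt_power2_gt by auto
      have "real ?n ^ 4 = (real (?n\<^sup>2))\<^sup>2"
        by simp
      also have "\<dots> \<le> (real N)\<^sup>2"
        using n by (intro power_mono) (simp_all del: of_nat_power)
      finally have "(S N x)\<^sup>2 / (real N)\<^sup>2 \<le> (S N x)\<^sup>2 / real ?n ^ 4"
        using n by (intro divide_left_mono) (auto simp: that)
      also have "\<dots> \<le> 2 * ((S (?n\<^sup>2) x)\<^sup>2 + G ?n x) / real ?n ^ 4"
        unfolding S_def G_def by (intro divide_right_mono sum_square_between_squares n) simp
      finally show ?thesis
        by (simp add: H_def power_divide)
    qed
    ultimately have "(\<lambda>N. (S N x / real N)\<^sup>2) \<longlonglongrightarrow> 0"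
      by (intro tendsto_sandwich[OF _ _ tendsto_const \<open>(\<lambda>N. 2 * H (floor_sqrt N) x) \<longlonglongrightarrow> 0\<close>])
        (auto intro: eventually_at_top_linorderI[of 1])
    then show "(\<lambda>n. (\<Sum>k<n. Y k x) / real n) \<longlonglongrightarrow> 0"
      unfolding S_def by (simp add: power_tendsto_0_iff)
  qed
qed


section \<open>One particle type\<close>

text \<open>\<open>matrix_inv\<close> is a choice among two-sided inverses, so its value is
  determined through their uniqueness.\<close>

lemma matrix_inv_eqI:
  fixes A :: "real^'n^'n"
  assumes "A ** B = mat 1" "B ** A = mat 1"
  shows "matrix_inv A = B"
proof -
  have "A ** matrix_inv A = mat 1 \<and> matrix_inv A ** A = mat 1"
    unfolding matrix_inv_def by (rule someI[of _ B]) (use assms in simp)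
  then show ?thesis
    by (metis assms(1) matrix_mul_assoc matrix_mul_lid matrix_mul_rid)
qed

lemma matrix_inv_diag:
  assumes "\<And>i. v $ i \<noteq> 0"
  shows "matrix_inv (diag v) = diag (\<chi> i. 1 / v $ i)"
  by (rule matrix_inv_eqI)
    (simp_all add: diag_def mat_def matrix_matrix_mult_def vec_eq_iff assms
      if_distrib[of "\<lambda>x. x * _"] if_distrib[of "\<lambda>x. _ * x"] cong: if_cong)

lemma mat_vector_mult: "mat k *v x = k *s (x :: 'a::semiring_1^'n)"
  by (simp add: vec_eq_iff mat_def matrix_vector_mult_def if_distrib[of "\<lambda>x. x * _"] cong: if_cong)

lemma mat_mult_mat: "mat a ** mat b = (mat (a * b) :: real^'n^'n)"
  by (simp add: vec_eq_iff mat_def matrix_matrix_mult_def if_distrib[of "\<lambda>x. x * _"] cong: if_cong)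

lemma matrix_inv_mat:
  assumes "c \<noteq> 0"
  shows "matrix_inv (mat c :: real^'n^'n) = mat (1 / c)"
  by (rule matrix_inv_eqI) (simp_all add: mat_mult_mat assms)

lemma mat_eq_scaleR: "mat a = a *\<^sub>R (mat 1 :: real^'n^'n)"
  by (simp add: vec_eq_iff mat_def)

lemma mexp_mat: "mexp (mat a :: real^'n^'n) = mat (exp a)"
proof -
  have "mprod (\<lambda>_. mat a :: real^'n^'n) k = mat (a ^ k)" for k
    by (induction k) (simp_all add: mat_mult_mat mult.commute)
  moreover have "(\<lambda>k. (a ^ k /\<^sub>R fact k) *\<^sub>R (mat 1 :: real^'n^'n)) sums (exp a *\<^sub>R mat 1)"
    by (intro sums_scaleR_left exp_converges)
  ultimately show ?thesis
    unfolding mexp_def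
    by (intro sums_unique[symmetric])
      (simp add: mat_eq_scaleR[of "exp a"] mat_eq_scaleR[of "a ^ _"] divide_inverse mult.commute)
qed

lemma complex_eigenvalues_mat: "complex_eigenvalues (mat a :: real^'n^'n) = {complex_of_real a}"
proof -
  have "map_matrix complex_of_real (mat a :: real^'n^'n) = mat (complex_of_real a)"
    by (simp add: vec_eq_iff mat_def map_matrix_def)
  moreover have "(1 :: complex^'n) \<noteq> 0"
    by simp
  ultimately show ?thesis
    by (auto simp: complex_eigenvalues_def mat_vector_mult vector_mul_rcancel)
qed

lemma dominant_eigenvalue_mat: "dominant_eigenvalue (mat a :: real^'n^'n) = a"
  unfolding dominant_eigenvalue_def complex_eigenvalues_mat by auto

text \<open>The vector of ones is an eigenvector for 1. For any other eigenvector, reading the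
  equation at a coordinate of largest modulus bounds the eigenvalue by a row sum.\<close>

lemma sp_stochastic:
  fixes K :: "real^'n^'n"
  assumes nn: "\<And>i j. 0 \<le> K $ i $ j" and sum: "\<And>i. (\<Sum>j\<in>UNIV. K $ i $ j) = 1"
  shows "sp K = 1"
  unfolding sp_def
proof (rule cSup_eq_maximum)
  have "map_matrix complex_of_real K *v 1 = 1 *s 1"
    by (simp add: vec_eq_iff map_matrix_def matrix_vector_mult_def sum flip: of_real_sum)
  then have "1 \<in> complex_eigenvalues K"
    unfolding complex_eigenvalues_def by (auto intro!: exI[of _ 1])
  then show "1 \<in> cmod ` complex_eigenvalues K"
    by force
next
  fix y assume "y \<in> cmod ` complex_eigenvalues K"
  then obtain z x where y: "y = cmod z" and x: "x \<noteq> 0"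
    and eig: "map_matrix complex_of_real K *v x = z *s x"
    by (auto simp: complex_eigenvalues_def)
  obtain i where i: "\<And>j. cmod (x $ j) \<le> cmod (x $ i)"
    using ex_is_arg_min_if_finite[of UNIV "\<lambda>i. - cmod (x $ i)"]
    by (auto simp: is_arg_min_linorder)
  obtain k where "x $ k \<noteq> 0"
    using x by (auto simp: vec_eq_iff)
  then have pos: "0 < cmod (x $ i)"
    using i[of k] by (meson less_le_trans zero_less_norm_iff)
  have "y * cmod (x $ i) = cmod (\<Sum>j\<in>UNIV. complex_of_real (K $ i $ j) * x $ j)"
    using arg_cong[OF eig, of "\<lambda>v. cmod (v $ i)"]
    by (simp add: y matrix_vector_mult_def map_matrix_def norm_mult)
  also have "\<dots> \<le> (\<Sum>j\<in>UNIV. K $ i $ j * cmod (x $ j))"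
    by (rule order_trans[OF norm_sum]) (simp add: norm_mult nn)
  also have "\<dots> \<le> (\<Sum>j\<in>UNIV. K $ i $ j * cmod (x $ i))"
    by (intro sum_mono mult_left_mono i nn)
  also have "\<dots> = 1 * cmod (x $ i)"
    by (simp add: sum flip: sum_distrib_right)
  finally show "y \<le> 1"
    using pos by (simp only: mult_le_cancel_right_pos)
qed

lemma kronecker_stochastic:
  fixes A :: "real^'m^'m" and B :: "real^'r^'r"
  assumes "\<And>i. (\<Sum>j\<in>UNIV. A $ i $ j) = 1" "\<And>i. (\<Sum>j\<in>UNIV. B $ i $ j) = 1"
  shows "(\<Sum>q\<in>UNIV. (A \<otimes>\<^sub>K B) $ p $ q) = 1"
proof -
  have "(\<Sum>q\<in>UNIV. (A \<otimes>\<^sub>K B) $ p $ q)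
    = (\<Sum>q\<in>UNIV \<times> UNIV. A $ fst p $ fst q * B $ snd p $ snd q)"
    by (simp add: kronecker_def)
  also have "\<dots> = (\<Sum>i\<in>UNIV. \<Sum>j\<in>UNIV. A $ fst p $ i * B $ snd p $ j)"
    by (simp add: sum.cartesian_product case_prod_unfold)
  finally show ?thesis
    by (simp add: assms flip: sum_distrib_left)
qed

lemma block_diag_mat_1: "block_diag (\<lambda>_. mat 1) = mat 1"
  by (auto simp: block_diag_def mat_def vec_eq_iff prod_eq_iff)

section \<open>Reduction of matrices of order one to scalars\<close>

lemma eq_of_card_1:
  assumes "CARD('r) = 1"
  shows "i = (j :: 'r)"
proof -
  obtain k :: 'r where "UNIV = {k}"
    using assms card_1_singletonE by blast
  then have "i \<in> {k}" "j \<in> {k}"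
    by auto
  then show ?thesis
    by simp
qed

lemma entries_mat:
  assumes "CARD('r) = 1"
  shows "(mat a :: real^'r^'r) $ i $ j = a"
  using eq_of_card_1[OF assms, of i j] by (simp add: mat_def)

text \<open>With a single index the matrix is \<open>mat\<close> of its only entry, and a scalar
  matrix has that scalar as its only eigenvalue.\<close>

lemma eq_mat_of_card_1:
  fixes A :: "real^'r^'r"
  assumes "CARD('r) = 1"
  shows "A = mat (dominant_eigenvalue A)"
proof -
  fix k :: 'r
  have "A $ i $ j = A $ k $ k" for i j
    using eq_of_card_1[OF assms, of i k] eq_of_card_1[OF assms, of j k] by simp
  then have "A = mat (A $ k $ k)"
    by (simp add: vec_eq_iff entries_mat[OF assms])
  then show ?thesis
    using dominant_eigenvalue_mat by metis
qed

lemma sum_card_1: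
  fixes f :: "'r::finite \<Rightarrow> real"
  assumes "CARD('r) = 1"
  shows "sum f UNIV = f i"
proof -
  have "sum f UNIV = (\<Sum>j\<in>(UNIV :: 'r set). f i)"
    by (intro sum.cong refl arg_cong[of _ _ f] eq_of_card_1[OF assms])
  then show ?thesis
    using assms by simp
qed

lemma left_eigenvector_card_1:
  fixes A :: "real^'r^'r"
  assumes "CARD('r) = 1"
  shows "left_eigenvector A = 1"
  unfolding left_eigenvector_def
proof (rule the_equality, intro conjI allI)
  show "(1 :: real^'r) v* A = dominant_eigenvalue A *\<^sub>R 1"
    by (subst eq_mat_of_card_1[OF assms, of A])
      (simp add: vec_eq_iff vector_matrix_mult_def mat_def)
next
  fix u :: "real^'r"
  assume "(\<forall>i. 0 < u $ i) \<and> u v* A = dominant_eigenvalue A *\<^sub>R u \<and> (\<Sum>i\<in>UNIV. u $ i) = 1"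
  then have "(\<Sum>i\<in>UNIV. u $ i) = 1"
    by simp
  then have "u $ i = 1" for i
    using sum_card_1[OF assms, of "($) u" i] by simp
  then show "u = 1"
    by (simp add: vec_eq_iff)
qed (use assms in simp_all)

lemma right_eigenvector_card_1:
  fixes A :: "real^'r^'r"
  assumes "CARD('r) = 1"
  shows "right_eigenvector A = 1"
  unfolding right_eigenvector_def left_eigenvector_card_1[OF assms]
proof (rule the_equality, intro conjI allI)
  show "A *v (1 :: real^'r) = dominant_eigenvalue A *\<^sub>R 1"
    by (subst eq_mat_of_card_1[OF assms, of A])
      (simp add: vec_eq_iff mat_vector_mult)
next
  fix v :: "real^'r"
  assume "(\<forall>i. 0 < v $ i) \<and> A *v v = dominant_eigenvalue A *\<^sub>R v \<and> 1 \<bullet> v = 1"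
  then have "(\<Sum>i\<in>UNIV. v $ i) = 1"
    by (simp add: inner_vec_def)
  then have "v $ i = 1" for i
    using sum_card_1[OF assms, of "($) v" i] by simp
  then show "v = 1"
    by (simp add: vec_eq_iff)
qed (use assms in \<open>simp_all add: inner_vec_def\<close>)

lemma Omega_star_card_1:
  fixes A :: "real^'r^'r"
  assumes "CARD('r) = 1"
  shows "Omega_star A = 0"
  using eq_mat_of_card_1[OF assms, of A] by (simp add: Omega_star_def)

lemma Theta_card_1:
  fixes A :: "real^'r^'r"
  assumes "CARD('r) = 1"
  shows "Theta A = 0"
  by (simp add: Theta_def Omega_star_card_1[OF assms] matrix_matrix_mult_def vec_eq_iff)

lemma M_block_card_1:
  fixes A :: "real^'r^'r"
  assumes "CARD('r) = 1" "c \<noteq> 0"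
  shows "M_block c A = mat 1"
proof -
  have "mat (c + dominant_eigenvalue A) - A = mat c"
    by (subst (2) eq_mat_of_card_1[OF assms(1), of A]) (simp add: vec_eq_iff mat_def)
  then show ?thesis
    using assms(2) by (simp add: M_block_def matrix_inv_mat mat_eq_scaleR[of "inverse c"] divide_inverse)
qed

section \<open>The bounds for a single type\<close>

lemma omega_U_card_1:
  fixes Omega :: "'m::finite \<Rightarrow> real^'r^'r"
  assumes "CARD('r) = 1" "\<And>l. rates Q $ l \<noteq> 0"
    and "\<And>i j. 0 \<le> jump_matrix Q $ i $ j" "\<And>i. (\<Sum>j\<in>UNIV. jump_matrix Q $ i $ j) = 1"
  shows "omega_U Q Omega = mean_rate Q Omega"
proof -
  have "sp (jump_matrix Q \<otimes>\<^sub>K (mat 1 :: real^'r^'r)) = 1"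
  proof (rule sp_stochastic)
    show "0 \<le> (jump_matrix Q \<otimes>\<^sub>K (mat 1 :: real^'r^'r)) $ p $ q" for p q
      using assms(3) by (simp add: kronecker_def mat_def)
    show "(\<Sum>q\<in>UNIV. (jump_matrix Q \<otimes>\<^sub>K (mat 1 :: real^'r^'r)) $ p $ q) = 1" for p
      by (rule kronecker_stochastic) (simp_all add: assms(4) mat_def)
  qed
  then show ?thesis
    using assms(1,2) by (simp add: omega_U_def M_mat_def M_block_card_1 block_diag_mat_1)
qed

lemma logv_stack_1: "logv (stack (\<lambda>_. 1)) = 0"
  by (simp add: logv_def stack_def vec_eq_iff)

text \<open>The correction is an inner product with the logarithm of the stacked right eigenvectors,
  which vanishes because each of them is the vector of ones.\<close>

lemma omega_L_card_1:
  fixes Omega :: "'m::finite \<Rightarrow> real^'r^'r"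
  assumes "CARD('r) = 1"
  shows "omega_L Q Omega = mean_rate Q Omega"
  by (simp add: omega_L_def right_eigenvector_card_1[OF assms] logv_stack_1)

lemma omega_L_tilde_card_1:
  fixes Omega :: "'m::finite \<Rightarrow> real^'r^'r"
  assumes "CARD('r) = 1"
  shows "omega_L_tilde Q Omega = mean_rate Q Omega"
  by (simp add: omega_L_tilde_def left_eigenvector_card_1[OF assms] logv_stack_1)

text \<open>All path weights and all values of \<open>R0\<close> equal 1, so numerator and
  denominator both count the bridges.\<close>

lemma cond_exp_R0_card_1:
  fixes Omega :: "'m::finite \<Rightarrow> real^'r^'r"
  assumes "CARD('r) = 1"
  shows "cond_exp_R0 Omega lab z i j = 1"
proof -
  have "mexp (0 :: real^'r^'r) = mat 1"
    using mexp_mat[where 'n = 'r, of 0] by (simp add: mat_0)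
  then have path: "path_prob Omega lab z \<phi> = 1" for \<phi>
    by (simp add: path_prob_def Theta_card_1[OF assms] entries_mat[OF assms])
  have R0: "R0 Omega lab \<phi> = 1" for \<phi>
    by (simp add: R0_def right_eigenvector_card_1[OF assms])
  have "finite (bridges TYPE('m) i j)"
    by (rule finite_subset[OF _ finite_PiE[of "{0..CARD('m)}" "\<lambda>_. UNIV :: 'r set"]])
      (auto simp: bridges_def)
  \<comment> \<open>The constant path is a bridge because \<open>i = j\<close>. So the count is
    positive and the quotient is 1 rather than the conventional value 0 of a division by
    zero.\<close>
  moreover have "(\<lambda>k\<in>{0..CARD('m)}. i) \<in> bridges TYPE('m) i j"
    using eq_of_card_1[OF assms, of i j] by (auto simp: bridges_def)
  ultimately have "card (bridges TYPE('m) i j) \<noteq> 0"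
    by auto
  then show ?thesis
    by (simp add: cond_exp_R0_def path R0)
qed

lemma omega_L_star_card_1:
  fixes Omega :: "'m::finite \<Rightarrow> real^'r^'r"
  assumes "CARD('r) = 1"
  shows "omega_L_star Q Omega lab = mean_rate Q Omega"
  by (simp add: omega_L_star_def cond_exp_R0_card_1[OF assms])

lemma mprod_mat: "mprod (\<lambda>k. mat (a k) :: real^'n^'n) n = mat (\<Prod>k<n. a k)"
  by (induction n) (simp_all add: mat_mult_mat)

lemma ln_mprod_mexp_card_1:
  fixes A :: "nat \<Rightarrow> real^'r^'r"
  assumes "CARD('r) = 1"
  shows "ln (mprod (\<lambda>k. mexp (t k *\<^sub>R A k)) n $ i $ j) = (\<Sum>k<n. dominant_eigenvalue (A k) * t k)"
proof -
  have "mexp (t k *\<^sub>R A k) = mat (exp (dominant_eigenvalue (A k) * t k))" for k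
  proof -
    have "t k *\<^sub>R A k = mat (dominant_eigenvalue (A k) * t k)"
      by (subst eq_mat_of_card_1[OF assms, of "A k"]) (simp add: vec_eq_iff mat_def mult.commute)
    then show ?thesis
      by (simp add: mexp_mat)
  qed
  then show ?thesis
    by (simp add: mprod_mat entries_mat[OF assms] flip: exp_sum)
qed


section \<open>The growth rate\<close>

text \<open>Conditioning on an event of positive probability is expressed by
  \<open>uniform_measure\<close>, whose density is the scaled indicator of \<open>A\<close>. Moments
  of sojourn times found under it are carried back to \<open>M\<close> here.\<close>

lemma (in prob_space) uniform_measure_integral:
  fixes f :: "'a \<Rightarrow> real"
  assumes A: "A \<in> events" "0 < prob A" and [measurable]: "f \<in> borel_measurable M"
    and int: "integrable (uniform_measure M A) f"
  shows "integrable M (\<lambda>x. indicator A x * f x)"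
    and "expectation (\<lambda>x. indicator A x * f x) = prob A * integral\<^sup>L (uniform_measure M A) f"
proof -
  note A(1)[measurable]
  have eq: "uniform_measure M A = density M (\<lambda>x. ennreal (indicator A x / prob A))"
    unfolding uniform_measure_def
    by (intro density_cong AE_I2)
      (use A in \<open>auto simp: emeasure_eq_measure divide_ennreal simp flip: ennreal_indicator\<close>)
  have "integrable M (\<lambda>x. indicator A x / prob A * f x)"
    using int unfolding eq by (subst (asm) integrable_density) auto
  then have "integrable M (\<lambda>x. prob A * (indicator A x / prob A * f x))"
    by (rule integrable_mult_right)
  then show "integrable M (\<lambda>x. indicator A x * f x)"
    using A by simp
  have "integral\<^sup>L (uniform_measure M A) f = expectation (\<lambda>x. indicator A x / prob A * f x)"
    unfolding eq by (subst integral_density) auto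
  also have "\<dots> = expectation (\<lambda>x. indicator A x * f x) / prob A"
    by (simp add: flip: integral_divide_zero)
  finally show "expectation (\<lambda>x. indicator A x * f x) = prob A * integral\<^sup>L (uniform_measure M A) f"
    using A by simp
qed

context random_environment
begin

declare Xhat_measurable [measurable] xi_measurable [measurable]

section \<open>The jump chain of the environment\<close>

lemma rates_eq: "rates Q $ i = - Q $ i $ i"
proof -
  have "Q $ i $ i + (\<Sum>j\<in>UNIV - {i}. Q $ i $ j) = 0"
    using Q_rows[of i] by (simp add: sum.remove[of UNIV i])
  moreover have "0 \<le> (\<Sum>j\<in>UNIV - {i}. Q $ i $ j)"
    by (intro sum_nonneg Q_offdiag) auto
  ultimately show ?thesis
    by (simp add: rates_def)
qed

lemma matrix_inv_rates: "matrix_inv (diag (rates Q)) = diag (\<chi> l. 1 / rates Q $ l)"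
  using rates_pos by (intro matrix_inv_diag) (metis less_irrefl)

text \<open>On the diagonal the identity cancels against
  \<open>Q $ i $ i / rates Q $ i = -1\<close>.\<close>

lemma jump_matrix_entry:
  "jump_matrix Q $ i $ j = (if i = j then 0 else Q $ i $ j / rates Q $ i)"
proof -
  have "(diag v ** Q) $ i $ j = v $ i * Q $ i $ j" for v
    by (simp add: diag_def matrix_matrix_mult_def if_distrib[of "\<lambda>x. x * _"] cong: if_cong)
  then have "jump_matrix Q $ i $ j = (if i = j then 1 else 0) + Q $ i $ j / rates Q $ i"
    by (simp add: jump_matrix_def matrix_inv_rates mat_def)
  then show ?thesis
    using rates_pos[of i] by (auto simp: rates_eq)
qed

lemma irreducible_stochastic_jump_matrix: "irreducible_stochastic (jump_matrix Q)"
proof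
  fix i j
  show "0 \<le> jump_matrix Q $ i $ j"
    using rates_pos[of i] Q_offdiag[of i j] by (simp add: jump_matrix_entry)
  have "(\<Sum>j\<in>UNIV. jump_matrix Q $ i $ j) = (\<Sum>j\<in>UNIV - {i}. Q $ i $ j / rates Q $ i)"
    by (subst sum.remove[of UNIV i]) (auto simp: jump_matrix_entry intro!: sum.cong)
  also have "\<dots> = ((\<Sum>j\<in>UNIV. Q $ i $ j) - Q $ i $ i) / rates Q $ i"
    by (simp add: sum.remove[of UNIV i] sum_divide_distrib)
  also have "\<dots> = 1"
    using Q_rows[of i] rates_pos[of i] by (simp add: rates_eq)
  finally show "(\<Sum>j\<in>UNIV. jump_matrix Q $ i $ j) = 1" .
next
  have "{(k, l). k \<noteq> l \<and> jump_matrix Q $ k $ l \<noteq> 0} = {(k, l). k \<noteq> l \<and> Q $ k $ l \<noteq> 0}"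
    using rates_pos by (auto simp: jump_matrix_entry) (metis less_irrefl)
  then show "irreducible_matrix (jump_matrix Q)"
    using Q_irreducible by (simp add: irreducible_matrix_def)
qed

sublocale jump: irreducible_stochastic "jump_matrix Q"
  by (rule irreducible_stochastic_jump_matrix)

lemma path_event [measurable]: "{x \<in> space M. \<forall>k\<le>(n::nat). Xhat k x = s k} \<in> events"
proof -
  have "{x \<in> space M. \<forall>k\<le>n. Xhat k x = s k} = {x \<in> space M. \<forall>k\<in>{..n}. Xhat k x = s k}"
    by auto
  also have "\<dots> \<in> events"
    by measurable
  finally show ?thesis .
qed

text \<open>The increments are orthogonal to every function \<open>F\<close> of the past. As
  \<open>jump_chain\<close> speaks of path probabilities, the expectation is expanded over the
  finitely many paths up to time \<open>k\<close>.\<close>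

lemma jump_chain_martingale:
  "expectation (\<lambda>x. F (\<lambda>i\<in>{..k}. Xhat i x) *
     (g $ Xhat (Suc k) x - (jump_matrix Q *v g) $ Xhat k x)) = 0"
proof -
  let ?h = "jump_matrix Q *v g"
  \<comment> \<open>\<open>A s\<close> fixes the history up to time \<open>k\<close>, and
    \<open>B s d\<close> extends it by the state \<open>d\<close>. The product formula for
    \<open>B s d\<close> also covers histories of probability zero, so nothing is divided
    out.\<close>
  define A where "A s = {x \<in> space M. \<forall>i\<le>k. Xhat i x = s i}" for s
  define B where "B s d = {x \<in> space M. \<forall>i\<le>Suc k. Xhat i x = (s(Suc k := d)) i}" for s d
  let ?S = "{..k} \<rightarrow>\<^sub>E (UNIV :: 'm set)"
  have [measurable]: "A s \<in> events" "B s d \<in> events" for s d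
    unfolding A_def B_def by (rule path_event)+
  have fin: "finite ?S"
    by (intro finite_PiE) auto
  have B_prob: "prob (B s d) = prob (A s) * jump_matrix Q $ s k $ d" for s d
    using jump_chain[of k "s(Suc k := d)"] by (simp add: A_def B_def)
  have "F (\<lambda>i\<in>{..k}. Xhat i x) * (g $ Xhat (Suc k) x - ?h $ Xhat k x) =
     (\<Sum>s\<in>?S. F s * ((\<Sum>d\<in>UNIV. g $ d * indicator (B s d) x) - ?h $ s k * indicator (A s) x))"
    if x: "x \<in> space M" for x
  proof -
    define s0 where "s0 = (\<lambda>i\<in>{..k}. Xhat i x)"
    have s0: "s0 \<in> ?S"
      by (auto simp: s0_def)
    have A_iff: "x \<in> A s \<longleftrightarrow> s = s0" if "s \<in> ?S" for s
    proof
      assume "x \<in> A s"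
      then show "s = s0"
        using that s0 by (intro PiE_ext[of s "{..k}" "\<lambda>_. UNIV"]) (auto simp: A_def s0_def)
    qed (use x in \<open>auto simp: A_def s0_def\<close>)
    have "x \<in> B s d \<longleftrightarrow> x \<in> A s \<and> d = Xhat (Suc k) x" for s d
      by (auto simp: A_def B_def le_Suc_eq)
    then have "F s * ((\<Sum>d\<in>UNIV. g $ d * indicator (B s d) x) - ?h $ s k * indicator (A s) x)
        = (if s = s0 then F s * (g $ Xhat (Suc k) x - ?h $ s k) else 0)" if "s \<in> ?S" for s
      using A_iff[OF that] by (auto simp: indicator_def if_distrib[of "\<lambda>x. _ * x"] cong: if_cong)
    then have "(\<Sum>s\<in>?S. F s * ((\<Sum>d\<in>UNIV. g $ d * indicator (B s d) x) - ?h $ s k * indicator (A s) x))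
        = (\<Sum>s\<in>?S. if s = s0 then F s * (g $ Xhat (Suc k) x - ?h $ s k) else 0)"
      by (rule sum.cong[OF refl])
    then show ?thesis
      using s0 fin by (simp add: s0_def)
  qed
  then have "expectation (\<lambda>x. F (\<lambda>i\<in>{..k}. Xhat i x) * (g $ Xhat (Suc k) x - ?h $ Xhat k x)) =
    expectation (\<lambda>x. \<Sum>s\<in>?S. F s * ((\<Sum>d\<in>UNIV. g $ d * indicator (B s d) x) - ?h $ s k * indicator (A s) x))"
    by (intro Bochner_Integration.integral_cong) auto
  also have "\<dots> = (\<Sum>s\<in>?S. F s * ((\<Sum>d\<in>UNIV. g $ d * prob (B s d)) - ?h $ s k * prob (A s)))"
    by (simp add: emeasure_eq_measure del: sum_mult_indicator)
  also have "\<dots> = 0"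
    by (intro sum.neutral ballI)
      (simp add: B_prob matrix_vector_mult_def sum_distrib_left mult_ac)
  finally show ?thesis .
qed

text \<open>The increments \<open>D k\<close> are bounded, and orthogonal because \<open>D j\<close>
  with \<open>j < k\<close> is a function of the path up to time \<open>k\<close>. The rest of the
  Poisson decomposition telescopes.\<close>

lemma jump_chain_law_of_large_numbers:
  "AE x in M. (\<lambda>n. (\<Sum>k<n. f $ Xhat k x) / real n) \<longlonglongrightarrow> pihat Q \<bullet> f"
proof -
  obtain g where g: "\<And>i. f $ i = g $ i - (jump_matrix Q *v g) $ i + pihat Q \<bullet> f"
    using jump.poisson_equation[of f] unfolding pihat_def by blast
  let ?h = "jump_matrix Q *v g"
  define D where "D k x = g $ Xhat (Suc k) x - ?h $ Xhat k x" for k x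
  define C where "C = (\<Sum>i\<in>UNIV. \<bar>g $ i\<bar>) + (\<Sum>i\<in>UNIV. \<bar>?h $ i\<bar>)"
  have [measurable]: "D k \<in> borel_measurable M" for k
    unfolding D_def[abs_def] by measurable
  have D_bound: "\<bar>D k x\<bar> \<le> C" for k x
    using member_le_sum[of "Xhat (Suc k) x" UNIV "\<lambda>i. \<bar>g $ i\<bar>"]
      member_le_sum[of "Xhat k x" UNIV "\<lambda>i. \<bar>?h $ i\<bar>"]
    by (simp add: D_def C_def)
  have D2: "(D k x)\<^sup>2 \<le> C\<^sup>2" for k x
    using power_mono[OF D_bound[of k x], of 2] by simp
  have "AE x in M. (\<lambda>n. (\<Sum>k<n. D k x) / real n) \<longlonglongrightarrow> 0"
  proof (rule strong_law_orthogonal)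
    show int: "integrable M (\<lambda>x. (D k x)\<^sup>2)" for k
      by (rule integrable_const_bound[of _ "C\<^sup>2"]) (auto simp: D2)
    show "expectation (\<lambda>x. (D k x)\<^sup>2) \<le> C\<^sup>2" for k
      using integral_mono[OF int, of "\<lambda>_. C\<^sup>2"] D2 by (simp add: prob_space)
    show "expectation (\<lambda>x. D j x * D k x) = 0" if "j < k" for j k
      using jump_chain_martingale[of "\<lambda>s. g $ s (Suc j) - ?h $ s j" k g] that
      by (simp add: D_def)
  qed simp
  then show ?thesis
  proof eventually_elim
    fix x
    assume lim: "(\<lambda>n. (\<Sum>k<n. D k x) / real n) \<longlonglongrightarrow> 0"
    \<comment> \<open>By the Poisson equation \<open>f\<close> at time \<open>k\<close> equals
      \<open>D k\<close>, plus the drop of \<open>g\<close> from time \<open>k\<close> to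
      \<open>Suc k\<close>, plus the stationary mean.\<close>
    have tele: "(\<Sum>k<n. f $ Xhat k x) = (\<Sum>k<n. D k x) + (g $ Xhat 0 x - g $ Xhat n x) + real n * (pihat Q \<bullet> f)" for n
      by (induction n) (simp_all add: D_def g[of "Xhat _ x"] algebra_simps)
    have "(\<lambda>n. (g $ Xhat 0 x - g $ Xhat n x) / real n) \<longlonglongrightarrow> 0"
    proof (rule Lim_null_comparison)
      have "\<bar>g $ Xhat 0 x - g $ Xhat n x\<bar> \<le> 2 * (\<Sum>i\<in>UNIV. \<bar>g $ i\<bar>)" for n
        using member_le_sum[of "Xhat 0 x" UNIV "\<lambda>i. \<bar>g $ i\<bar>"]
          member_le_sum[of "Xhat n x" UNIV "\<lambda>i. \<bar>g $ i\<bar>"] by simp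
      then show "\<forall>\<^sub>F n in sequentially.
          norm ((g $ Xhat 0 x - g $ Xhat n x) / real n) \<le> 2 * (\<Sum>i\<in>UNIV. \<bar>g $ i\<bar>) / real n"
        by (intro always_eventually allI) (simp add: divide_right_mono)
    qed (rule lim_const_over_n)
    then have "(\<lambda>n. (\<Sum>k<n. D k x) / real n + (g $ Xhat 0 x - g $ Xhat n x) / real n
        + pihat Q \<bullet> f) \<longlonglongrightarrow> 0 + 0 + pihat Q \<bullet> f"
      by (intro tendsto_add lim tendsto_const)
    moreover have "\<forall>\<^sub>F n in sequentially. (\<Sum>k<n. D k x) / real n + (g $ Xhat 0 x - g $ Xhat n x) / real n
        + pihat Q \<bullet> f = (\<Sum>k<n. f $ Xhat k x) / real n"
      using eventually_gt_at_top[of 0]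
      by eventually_elim (simp add: tele field_simps)
    ultimately have "(\<lambda>n. (\<Sum>k<n. f $ Xhat k x) / real n) \<longlonglongrightarrow> 0 + 0 + pihat Q \<bullet> f"
      by (rule Lim_transform_eventually)
    then show "(\<lambda>n. (\<Sum>k<n. f $ Xhat k x) / real n) \<longlonglongrightarrow> pihat Q \<bullet> f"
      by simp
  qed
qed

section \<open>Sojourn times given the jump chain\<close>

lemma exp_law_UNIV: "measure (exp_law (rates Q $ l)) UNIV = 1"
proof -
  interpret L: prob_space "exp_law (rates Q $ l)"
    unfolding exp_law_def by (rule prob_space_exponential_density[OF rates_pos])
  show ?thesis
    using L.prob_space by (simp add: exp_law_def)
qed

lemma state_event [measurable]:
  "finite I \<Longrightarrow> {x \<in> space M. \<forall>k\<in>I. Xhat k x = s k} \<in> events"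
  by measurable

text \<open>The conditional probability given the whole jump chain is integrated over an event of
  that chain on which it is almost surely constant.\<close>

lemma sojourn_joint_prob:
  assumes fin: "finite I" and B: "\<And>k. k \<in> I \<Longrightarrow> B k \<in> sets borel"
  shows "\<P>(x in M. (\<forall>k\<in>I. Xhat k x = s k) \<and> (\<forall>k\<in>I. xi k x \<in> B k))
    = \<P>(x in M. \<forall>k\<in>I. Xhat k x = s k) * (\<Prod>k\<in>I. measure (exp_law (rates Q $ s k)) (B k))"
proof -
  let ?V = "vimage_algebra (space M) (\<lambda>x k. Xhat k x) (\<Pi>\<^sub>M k\<in>(UNIV :: nat set). count_space (UNIV :: 'm set))"
  obtain n where n: "I \<subseteq> {..n}"
    using fin by (meson finite_nat_iff_bounded_le)
  \<comment> \<open>\<open>sojourn_times\<close> concerns an initial segment of times. Outside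
    \<open>I\<close> the sets are padded with \<open>UNIV\<close>, which contributes factors
    1.\<close>
  define B' where "B' k = (if k \<in> I then B k else UNIV)" for k
  have B' [measurable]: "B' k \<in> sets borel" for k
    using B by (simp add: B'_def)
  define A where "A = {x \<in> space M. \<forall>k\<in>I. Xhat k x = s k}"
  define E where "E = {x \<in> space M. \<forall>k\<le>n. xi k x \<in> B' k}"
  have E_eq: "E = {x \<in> space M. \<forall>k\<in>I. xi k x \<in> B k}"
    using n by (auto simp: E_def B'_def)
  have "E = {x \<in> space M. \<forall>k\<in>{..n}. xi k x \<in> B' k}"
    by (auto simp: E_def)
  also have "\<dots> \<in> events"
    by measurable
  finally have E: "E \<in> events" .
  have "(\<lambda>x k. Xhat k x) \<in> measurable M (\<Pi>\<^sub>M k\<in>(UNIV :: nat set). count_space (UNIV :: 'm set))"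
    by (intro measurable_PiM_single') auto
  then have "sets ?V \<subseteq> sets M"
    by (rule sets_image_in_sets[OF refl])
  then interpret V: finite_measure_subalgebra M ?V
    by unfold_locales (simp add: subalgebra_def)
  have A_events: "A \<in> events"
    unfolding A_def using fin by (rule state_event)
  have A_V: "A \<in> sets ?V"
  proof -
    have "{w \<in> space (\<Pi>\<^sub>M k\<in>(UNIV :: nat set). count_space (UNIV :: 'm set)). \<forall>k\<in>I. w k = s k}
        \<in> sets (\<Pi>\<^sub>M k\<in>(UNIV :: nat set). count_space (UNIV :: 'm set))"
      using fin by measurable
    from in_vimage_algebra[OF this, of "\<lambda>x k. Xhat k x" "space M"] show ?thesis
      by (simp add: A_def space_PiM vimage_def Int_def conj_commute)
  qed
  have "prob (A \<inter> E) = (\<integral>x\<in>A. indicator E x \<partial>M)"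
    using A_events E by (simp add: set_lebesgue_integral_def indicator_inter_arith[symmetric])
  also have "\<dots> = (\<integral>x\<in>A. real_cond_exp M ?V (indicator E) x \<partial>M)"
    using E A_V by (intro V.real_cond_exp_intA) (simp_all add: emeasure_eq_measure)
  also have "\<dots> = (\<integral>x\<in>A. (\<Prod>k\<in>I. measure (exp_law (rates Q $ s k)) (B k)) \<partial>M)"
    unfolding set_lebesgue_integral_def
  proof (rule integral_cong_AE)
    have "AE x in M. real_cond_exp M ?V (indicator E) x
        = (\<Prod>k\<le>n. measure (exp_law (rates Q $ Xhat k x)) (B' k))"
      unfolding E_def by (rule sojourn_times) (rule B')
    then show "AE x in M. indicator A x *\<^sub>R real_cond_exp M ?V (indicator E) x
        = indicator A x *\<^sub>R (\<Prod>k\<in>I. measure (exp_law (rates Q $ s k)) (B k))"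
    proof eventually_elim
      case (elim x)
      have "(\<Prod>k\<le>n. measure (exp_law (rates Q $ Xhat k x)) (B' k))
          = (\<Prod>k\<in>I. measure (exp_law (rates Q $ s k)) (B k))" if "x \<in> A"
        using that n
        by (intro prod.mono_neutral_cong_right) (auto simp: A_def B'_def exp_law_UNIV)
      then show ?case
        using elim by (simp add: indicator_def)
    qed
  qed (use A_events in auto)
  also have "\<dots> = prob A * (\<Prod>k\<in>I. measure (exp_law (rates Q $ s k)) (B k))"
    using A_events by (simp add: set_lebesgue_integral_def)
  finally show ?thesis
    unfolding A_def E_eq by (simp add: Int_def conj_ac)
qed

text \<open>All sets but that at time \<open>k\<close> are taken to be \<open>UNIV\<close>. The
  event may fix further states besides the one at \<open>k\<close>: the cross terms condition on two
  of them.\<close>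

lemma sojourn_conditional_law:
  fixes I s
  defines "A \<equiv> {x \<in> space M. \<forall>k\<in>I. Xhat k x = s k}"
  assumes fin: "finite I" and pos: "0 < prob A" and k: "k \<in> I"
  shows "distributed (uniform_measure M A) lborel (xi k) (exponential_density (rates Q $ s k))"
proof -
  have A [measurable]: "A \<in> events"
    unfolding A_def using fin by (rule state_event)
  interpret U: prob_space "uniform_measure M A"
    using pos by (intro prob_space_uniform_measure) (auto simp: emeasure_eq_measure)
  interpret L: prob_space "exp_law (rates Q $ s k)"
    unfolding exp_law_def by (rule prob_space_exponential_density[OF rates_pos])
  have "distr (uniform_measure M A) lborel (xi k) = exp_law (rates Q $ s k)"
  proof (rule measure_eqI)
    fix B assume "B \<in> sets (distr (uniform_measure M A) lborel (xi k))"
    then have B [measurable]: "B \<in> sets borel"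
      by simp
    have "prob (A \<inter> {x \<in> space M. xi k x \<in> B}) = prob A * measure (exp_law (rates Q $ s k)) B"
    proof -
      have "A \<inter> {x \<in> space M. xi k x \<in> B} = {x \<in> space M. (\<forall>i\<in>I. Xhat i x = s i)
          \<and> (\<forall>i\<in>I. xi i x \<in> (if i = k then B else UNIV))}"
        using k by (auto simp: A_def)
      then show ?thesis
        using sojourn_joint_prob[OF fin, of "\<lambda>i. if i = k then B else UNIV" s] k fin
        by (simp add: A_def if_distrib[of "measure _"] exp_law_UNIV prod.delta prod.If_cases
            cong: if_cong)
    qed
    then show "emeasure (distr (uniform_measure M A) lborel (xi k)) B = emeasure (exp_law (rates Q $ s k)) B"
      using pos
      by (simp add: emeasure_distr emeasure_eq_measure L.emeasure_eq_measure vimage_def Int_def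
          divide_ennreal conj_commute)
  qed (simp add: exp_law_def)
  then show ?thesis
    by (simp add: distributed_def exp_law_def)
qed

text \<open>The joint law and the product of the marginals agree on rectangles, by the product
  formula for two times.\<close>

lemma sojourn_conditional_indep:
  fixes j k s
  defines "A \<equiv> {x \<in> space M. \<forall>i\<in>{j, k}. Xhat i x = s i}"
  assumes pos: "0 < prob A" and neq: "j \<noteq> k"
  shows "prob_space.indep_var (uniform_measure M A) borel (xi j) borel (xi k)"
proof -
  have A [measurable]: "A \<in> events"
    unfolding A_def by (rule state_event) simp
  interpret U: prob_space "uniform_measure M A"
    using pos by (intro prob_space_uniform_measure) (auto simp: emeasure_eq_measure)
  have law: "distr (uniform_measure M A) borel (xi i) = exp_law (rates Q $ s i)" if "i \<in> {j, k}" for i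
  proof -
    have "distr (uniform_measure M A) lborel (xi i) = exp_law (rates Q $ s i)"
      using sojourn_conditional_law[of "{j, k}" s i] pos that
      unfolding A_def distributed_def exp_law_def by blast
    then show ?thesis
      by (metis (no_types) distr_cong sets_lborel)
  qed
  have L: "prob_space (exp_law (rates Q $ l))" for l
    unfolding exp_law_def by (rule prob_space_exponential_density[OF rates_pos])
  show ?thesis
    unfolding U.indep_var_distribution_eq
  proof (intro conjI)
    show "distr (uniform_measure M A) borel (xi j) \<Otimes>\<^sub>M distr (uniform_measure M A) borel (xi k)
      = distr (uniform_measure M A) (borel \<Otimes>\<^sub>M borel) (\<lambda>x. (xi j x, xi k x))"
    proof (rule pair_measure_eqI)
      fix B C assume "B \<in> sets (distr (uniform_measure M A) borel (xi j))"
        and "C \<in> sets (distr (uniform_measure M A) borel (xi k))"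
      then have [measurable]: "B \<in> sets borel" "C \<in> sets borel"
        by simp_all
      let ?E = "{x \<in> space M. xi j x \<in> B \<and> xi k x \<in> C}"
      have "A \<inter> ?E = {x \<in> space M. (\<forall>i\<in>{j, k}. Xhat i x = s i)
          \<and> (\<forall>i\<in>{j, k}. xi i x \<in> (if i = j then B else C))}"
        using neq by (auto simp: A_def)
      then have "prob (A \<inter> ?E)
          = prob A * (measure (exp_law (rates Q $ s j)) B * measure (exp_law (rates Q $ s k)) C)"
        using sojourn_joint_prob[of "{j, k}" "\<lambda>i. if i = j then B else C" s] neq
        by (simp add: A_def)
      moreover have "(\<lambda>x. (xi j x, xi k x)) -` (B \<times> C) \<inter> space M = ?E"
        by auto
      ultimately show "emeasure (distr (uniform_measure M A) borel (xi j)) B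
          * emeasure (distr (uniform_measure M A) borel (xi k)) C
        = emeasure (distr (uniform_measure M A) (borel \<Otimes>\<^sub>M borel) (\<lambda>x. (xi j x, xi k x))) (B \<times> C)"
        using pos
        by (simp add: law emeasure_distr emeasure_eq_measure divide_ennreal
            finite_measure.emeasure_eq_measure[OF prob_space.finite_measure[OF L]]
            flip: ennreal_mult'')
    next
      show "sets (distr (uniform_measure M A) borel (xi j) \<Otimes>\<^sub>M distr (uniform_measure M A) borel (xi k))
        = sets (distr (uniform_measure M A) (borel \<Otimes>\<^sub>M borel) (\<lambda>x. (xi j x, xi k x)))"
        unfolding sets_distr by (intro sets_pair_measure_cong sets_distr)
    qed (simp_all add: law L prob_space_imp_sigma_finite)
  qed simp_all
qed

text \<open>Second moments and cross products are split according to the visited states. Given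
  these, the sojourn times are independent exponentials centred at their means, so the strong law
  for orthogonal variables applies.\<close>

lemma sojourn_law_of_large_numbers:
  "AE x in M. (\<lambda>n. (\<Sum>k<n. a $ Xhat k x * (xi k x - 1 / rates Q $ Xhat k x)) / real n) \<longlonglongrightarrow> 0"
proof (rule strong_law_orthogonal)
  \<comment> \<open>For the exponential law with parameter \<open>rates Q $ i\<close> this is both
    the mean and the standard deviation.\<close>
  define c where "c i = 1 / rates Q $ i" for i
  define Z where "Z k x = a $ Xhat k x * (xi k x - 1 / rates Q $ Xhat k x)" for k x
  have [measurable]: "Z k \<in> borel_measurable M" for k
    unfolding Z_def[abs_def] by measurable
  show "(\<lambda>x. a $ Xhat k x * (xi k x - 1 / rates Q $ Xhat k x)) \<in> borel_measurable M" for k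
    by measurable

  \<comment> \<open>Under the conditional measure the second moment is exactly
    \<open>(c p)\<^sup>2\<close>; the inequality absorbs the probability of the event. Null events
    cannot be conditioned on and are treated separately.\<close>
  have sq: "integrable M (\<lambda>x. indicator {x \<in> space M. Xhat k x = p} x * (xi k x - c p)\<^sup>2)"
    "expectation (\<lambda>x. indicator {x \<in> space M. Xhat k x = p} x * (xi k x - c p)\<^sup>2) \<le> (c p)\<^sup>2" for k p
  proof -
    let ?A = "{x \<in> space M. Xhat k x = p}"
    have A [measurable]: "?A \<in> events"
      by measurable
    have "integrable M (\<lambda>x. indicator ?A x * (xi k x - c p)\<^sup>2)
      \<and> expectation (\<lambda>x. indicator ?A x * (xi k x - c p)\<^sup>2) \<le> (c p)\<^sup>2"
    proof (cases "prob ?A = 0")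
      case True
      then have "AE x in M. x \<notin> ?A"
        using A by (simp add: AE_iff_measurable[OF A] emeasure_eq_measure)
      then have zero: "AE x in M. indicator ?A x * (xi k x - c p)\<^sup>2 = 0"
        by eventually_elim (auto simp: indicator_def)
      then show ?thesis
        by (simp add: integrable_cong_AE[OF _ _ zero] integral_cong_AE[OF _ _ zero])
    next
      case False
      then have pos: "0 < prob ?A"
        by (simp add: zero_less_measure_iff)
      interpret U: prob_space "uniform_measure M ?A"
        using pos by (intro prob_space_uniform_measure) (auto simp: emeasure_eq_measure)
      have D: "distributed (uniform_measure M ?A) lborel (xi k) (exponential_density (rates Q $ p))"
        using sojourn_conditional_law[of "{k}" "\<lambda>_. p" k] pos by simp
      have int: "integrable (uniform_measure M ?A) (\<lambda>x. (xi k x - c p)\<^sup>2)"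
        using U.erlang_ith_moment_integrable[OF rates_pos D, of 1]
          U.erlang_ith_moment_integrable[OF rates_pos D, of 2]
        by (simp add: power2_diff)
      have "U.expectation (\<lambda>x. (xi k x - c p)\<^sup>2) = (c p)\<^sup>2"
        using U.exponential_distributed_variance[OF rates_pos D]
          U.exponential_distributed_expectation[OF rates_pos D]
        by (simp add: c_def power_divide)
      then show ?thesis
        using uniform_measure_integral[OF A pos _ int] by (simp add: mult_left_le_one_le)
    qed
    then show "integrable M (\<lambda>x. indicator ?A x * (xi k x - c p)\<^sup>2)"
      "expectation (\<lambda>x. indicator ?A x * (xi k x - c p)\<^sup>2) \<le> (c p)\<^sup>2"
      by auto
  qed
  have Z2: "(Z k x)\<^sup>2 = (\<Sum>p\<in>UNIV. (a $ p)\<^sup>2 * (indicator {x \<in> space M. Xhat k x = p} x * (xi k x - c p)\<^sup>2))"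
    if "x \<in> space M" for k x
  proof -
    have "(\<Sum>p\<in>UNIV. (a $ p)\<^sup>2 * (indicator {x \<in> space M. Xhat k x = p} x * (xi k x - c p)\<^sup>2))
      = (\<Sum>p\<in>UNIV. if p = Xhat k x then (a $ p)\<^sup>2 * (xi k x - c p)\<^sup>2 else 0)"
      using that by (intro sum.cong) (auto simp: indicator_def)
    then show ?thesis
      by (simp add: Z_def c_def power_mult_distrib)
  qed
  show "integrable M (\<lambda>x. (a $ Xhat k x * (xi k x - 1 / rates Q $ Xhat k x))\<^sup>2)" for k
    unfolding Z_def[symmetric]
    by (subst Bochner_Integration.integrable_cong[OF refl Z2])
      (auto intro!: Bochner_Integration.integrable_sum integrable_mult_right sq)
  show "expectation (\<lambda>x. (a $ Xhat k x * (xi k x - 1 / rates Q $ Xhat k x))\<^sup>2)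
      \<le> (\<Sum>p\<in>UNIV. (a $ p)\<^sup>2 * (c p)\<^sup>2)" for k
    unfolding Z_def[symmetric]
    by (subst Bochner_Integration.integral_cong[OF refl Z2])
      (auto simp: sq intro!: sum_mono mult_left_mono sq)

  fix j k :: nat assume "j < k"
  then have neq: "j \<noteq> k" by simp
  \<comment> \<open>On a non-null event, conditional independence factors the expectation, and the
    first factor is a centred mean, hence zero.\<close>
  have cross: "integrable M (\<lambda>x. indicator {x \<in> space M. Xhat j x = p \<and> Xhat k x = q} x * ((xi j x - c p) * (xi k x - c q)))
    \<and> expectation (\<lambda>x. indicator {x \<in> space M. Xhat j x = p \<and> Xhat k x = q} x * ((xi j x - c p) * (xi k x - c q))) = 0" for p q
  proof -
    let ?A = "{x \<in> space M. Xhat j x = p \<and> Xhat k x = q}"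
    have A [measurable]: "?A \<in> events"
      by measurable
    show ?thesis
    proof (cases "prob ?A = 0")
      case True
      then have "AE x in M. x \<notin> ?A"
        using A by (simp add: AE_iff_measurable[OF A] emeasure_eq_measure)
      then have zero: "AE x in M. indicator ?A x * ((xi j x - c p) * (xi k x - c q)) = 0"
        by eventually_elim (auto simp: indicator_def)
      then show ?thesis
        by (simp add: integrable_cong_AE[OF _ _ zero] integral_cong_AE[OF _ _ zero])
    next
      case False
      then have pos: "0 < prob ?A"
        by (simp add: zero_less_measure_iff)
      interpret U: prob_space "uniform_measure M ?A"
        using pos by (intro prob_space_uniform_measure) (auto simp: emeasure_eq_measure)
      have A_eq: "?A = {x \<in> space M. \<forall>i\<in>{j, k}. Xhat i x = ((\<lambda>_. q)(j := p)) i}"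
        using neq by auto
      have indep: "U.indep_var borel (xi j) borel (xi k)"
        using sojourn_conditional_indep[of j k "(\<lambda>_. q)(j := p)", folded A_eq] pos neq by simp
      have Dj: "distributed (uniform_measure M ?A) lborel (xi j) (exponential_density (rates Q $ p))"
        using sojourn_conditional_law[of "{j, k}" "(\<lambda>_. q)(j := p)" j, folded A_eq] pos neq by simp
      have Dk: "distributed (uniform_measure M ?A) lborel (xi k) (exponential_density (rates Q $ q))"
        using sojourn_conditional_law[of "{j, k}" "(\<lambda>_. q)(j := p)" k, folded A_eq] pos neq by simp
      have int: "integrable (uniform_measure M ?A) (\<lambda>x. xi j x - c p)"
          "integrable (uniform_measure M ?A) (\<lambda>x. xi k x - c q)"
        using U.erlang_ith_moment_integrable[OF rates_pos Dj, of 1]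
          U.erlang_ith_moment_integrable[OF rates_pos Dk, of 1] by simp_all
      have zero: "U.expectation (\<lambda>x. xi j x - c p) = 0"
        using U.exponential_distributed_expectation[OF rates_pos Dj]
          U.erlang_ith_moment_integrable[OF rates_pos Dj, of 1] U.prob_space
        by (simp add: c_def)
      have indep': "U.indep_var borel (\<lambda>x. xi j x - c p) borel (\<lambda>x. xi k x - c q)"
        using U.indep_var_compose[OF indep, of "\<lambda>t. t - c p" borel "\<lambda>t. t - c q" borel]
        by (simp add: comp_def)
      show ?thesis
        using uniform_measure_integral[OF A pos _ U.indep_var_integrable[OF indep' int]]
          U.indep_var_lebesgue_integral[OF indep' int] zero by simp
    qed
  qed
  have ZZ: "Z j x * Z k x = (\<Sum>p\<in>UNIV. \<Sum>q\<in>UNIV. a $ p * a $ q *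
      (indicator {x \<in> space M. Xhat j x = p \<and> Xhat k x = q} x * ((xi j x - c p) * (xi k x - c q))))"
    if "x \<in> space M" for x
  proof -
    have "(\<Sum>p\<in>UNIV. \<Sum>q\<in>UNIV. a $ p * a $ q *
        (indicator {x \<in> space M. Xhat j x = p \<and> Xhat k x = q} x * ((xi j x - c p) * (xi k x - c q))))
      = (\<Sum>p\<in>UNIV. \<Sum>q\<in>UNIV. if q = Xhat k x then if p = Xhat j x then
          a $ p * a $ q * ((xi j x - c p) * (xi k x - c q)) else 0 else 0)"
      using that by (intro sum.cong) (auto simp: indicator_def)
    then show ?thesis
      by (simp add: Z_def c_def mult_ac)
  qed
  show "expectation (\<lambda>x. a $ Xhat j x * (xi j x - 1 / rates Q $ Xhat j x) *
      (a $ Xhat k x * (xi k x - 1 / rates Q $ Xhat k x))) = 0"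
    unfolding Z_def[symmetric]
    by (subst Bochner_Integration.integral_cong[OF refl ZZ])
      (auto simp: cross)
qed

section \<open>Identification of the growth rate\<close>

lemma is_growth_rate_card_1:
  fixes Omega :: "'m \<Rightarrow> real^'r^'r"
  assumes r: "CARD('r) = 1"
  shows "is_growth_rate M Xhat xi Omega (mean_rate Q Omega)"
proof -
  define a where "a = (\<chi> l. dominant_eigenvalue (Omega l))"
  have mean: "mean_rate Q Omega = pihat Q \<bullet> (\<chi> l. a $ l / rates Q $ l)"
    unfolding mean_rate_def matrix_inv_rates
    by (simp add: diag_def vector_matrix_mult_def inner_vec_def
        if_distrib[of "\<lambda>x. _ * x"] if_distrib[of "\<lambda>x. x * _"] a_def mult_ac cong: if_cong)
  show ?thesis
    unfolding is_growth_rate_def mean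
    using sojourn_law_of_large_numbers[of a]
      jump_chain_law_of_large_numbers[of "\<chi> l. a $ l / rates Q $ l"]
  proof eventually_elim
    case (elim x)
    have "1 / real n * ln (mprod (\<lambda>k. mexp (xi k x *\<^sub>R Omega (Xhat k x))) n $ i $ j)
      = (\<Sum>k<n. a $ Xhat k x * (xi k x - 1 / rates Q $ Xhat k x)) / real n
        + (\<Sum>k<n. (\<chi> l. a $ l / rates Q $ l) $ Xhat k x) / real n" for n i j
      by (simp add: ln_mprod_mexp_card_1[OF r] a_def algebra_simps sum_subtractf add_divide_distrib diff_divide_distrib)
    then show ?case
      using tendsto_add[OF elim] by simp
  qed
qed

text \<open>Two almost sure constant limits agree almost surely, and on a probability space a
  deterministic equality that holds almost surely is true.\<close>

lemma growth_rate_eqI: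
  assumes w: "is_growth_rate M Xhat xi Omega w"
  shows "growth_rate M Xhat xi Omega = w"
  unfolding growth_rate_def
proof (rule the_equality)
  fix w' assume "is_growth_rate M Xhat xi Omega w'"
  with w have "AE x in M. w' = w"
    unfolding is_growth_rate_def by eventually_elim (meson LIMSEQ_unique)
  then show "w' = w"
    by simp
qed (rule w)

end

text \<open>\<open>growth_rate\<close> is a definite description, so the first conjunct records that
  the limit exists. In the cyclic case \<open>lab\<close> lists the states in the order in which
  they are visited, starting from label 1.\<close>

theorem lemma6p1:
  fixes M :: "'a measure"
    and Q :: "real^'m^'m"
    and X :: "real \<Rightarrow> 'a \<Rightarrow> 'm"
    and Xhat :: "nat \<Rightarrow> 'a \<Rightarrow> 'm"
    and xi :: "nat \<Rightarrow> 'a \<Rightarrow> real"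
    and Omega :: "'m \<Rightarrow> real^'r^'r"
  assumes "random_environment M Q X Xhat xi"
    and "\<And>l. irreducible_matrix (Omega l)"
    and "\<And>l i j. i \<noteq> j \<Longrightarrow> 0 \<le> Omega l $ i $ j"
    and "CARD('r) = 1"
  shows "is_growth_rate M Xhat xi Omega (growth_rate M Xhat xi Omega)
    \<and> omega_L Q Omega = omega_L_tilde Q Omega
    \<and> omega_L_tilde Q Omega = omega_U Q Omega
    \<and> omega_U Q Omega = growth_rate M Xhat xi Omega
    \<and> growth_rate M Xhat xi Omega = (pihat Q v* matrix_inv (diag (rates Q))) \<bullet> (\<chi> l. dominant_eigenvalue (Omega l))
    \<and> (\<forall>lab. bij_betw lab {1..CARD('m)} UNIV
           \<and> (AE x in M. \<forall>k. Xhat k x = lab (k mod CARD('m) + 1))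
         \<longrightarrow> omega_L_star Q Omega lab = growth_rate M Xhat xi Omega)"
proof -
  interpret random_environment M Q X Xhat xi
    by (rule assms(1))
  have rate: "is_growth_rate M Xhat xi Omega (mean_rate Q Omega)"
    using assms(4) by (rule is_growth_rate_card_1)
  have "rates Q $ l \<noteq> 0" for l
    using rates_pos[of l] by simp
  then have "omega_U Q Omega = mean_rate Q Omega"
    using jump.nonneg jump.row_sum by (intro omega_U_card_1 assms(4))
  then show ?thesis
    unfolding growth_rate_eqI[OF rate] omega_L_card_1[OF assms(4)] omega_L_tilde_card_1[OF assms(4)]
      omega_L_star_card_1[OF assms(4)]
    using rate by (simp add: mean_rate_def)
qed

end
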